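(* Let $n,m\ge 2$ be integers and let $\mathfrak{u}$ be one of the compact Lie algebras $\mathfrak{su}(m)$, $\mathfrak{so}(m)$ or $\mathfrak{sp}(m)$. Put $r=m$ if $\mathfrak{u}=\mathfrak{su}(m)$ or $\mathfrak{so}(m)$, and $r=2m$ if $\mathfrak{u}=\mathfrak{sp}(m)$. Let $V=\mathcal{P}_n(\mathbb{C}^r)$ be the standard real representation of $\mathfrak{u}$ on the space of complex homogeneous polynomials of degree $n$ in $r$ variables. Let $\mathfrak{l}=(\mathbb{R}Z\oplus\mathfrak{u})\ltimes V$ be the real Lie algebra in which $V$ is an abelian ideal, $\mathfrak{u}$ is a subalgebra acting on $V$ by this representation, $[Z,\mathfrak{u}]=0$, and $Z$ acts as the identity on $V$. Then $\mathfrak{l}$ admits an inner product with negative Ricci curvature.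
   Context: Standard representation: $\mathcal{P}_n(\mathbb{C}^r)$ is the space of complex homogeneous polynomials of degree $n$ in $r$ variables, regarded as a real vector space (of real dimension $2\binom{n+r-1}{n}$). The matrix Lie algebra $\mathfrak{u}\subset\mathfrak{gl}(r,\mathbb{C})$ acts on it by $(\pi(X)P)(z)=\frac{d}{dt}\big|_{t=0}P(e^{-tX}z)$. Here $\mathfrak{su}(m)$ is the set of traceless skew-Hermitian $m\times m$ matrices, $\mathfrak{so}(m)$ is the set of real skew-symmetric $m\times m$ matrices (so the representation may equivalently be viewed on complex-valued homogeneous polynomials on $\mathbb{R}^m$), and $\mathfrak{sp}(m)=\mathfrak{sp}(m,\mathbb{C})\cap\mathfrak{u}(2m)$ is the compact real form of $\mathfrak{sp}(m,\mathbb{C})\subset\mathfrak{gl}(2m,\mathbb{C})$. Ricci curvature: an inner product $\langle\cdot,\cdot\rangle$ on a real finite-dimensional Lie algebra $\mathfrak{g}$ has negative Ricci curvature if the Ricci operator of the corresponding left-invariant Riemannian metric on a Lie group with Lie algebra $\mathfrak{g}$ is negative definite. Explicitly, the Ricci operator is $\operatorname{Ric}=M-\tfrac12 B-S(\operatorname{ad}H)$, where $H\in\mathfrak{g}$ is defined by $\langle H,X\rangle=\operatorname{tr}\operatorname{ad}X$ for all $X$, $S(A)=\tfrac12(A+A^t)$, $B$ is the symmetric operator with $\langle BX,X\rangle=\operatorname{tr}(\operatorname{ad}X)^2$, and $M$ is the symmetric operator with $\langle MX,X\rangle=-\tfrac12\sum_{i,j}\langle[X,X_i],X_j\rangle^2+\tfrac14\sum_{i,j}\langle[X_i,X_j],X\rangle^2$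 for any orthonormal basis $\{X_i\}$ of $\mathfrak{g}$. *)

theory Defs
  imports "HOL-Analysis.Analysis" "HOL-Library.Function_Algebras"
begin

instantiation "fun" :: (type, real_vector) real_vector
begin

definition scaleR_fun :: "real \<Rightarrow> ('a \<Rightarrow> 'b) \<Rightarrow> 'a \<Rightarrow> 'b"
  where "scaleR_fun c f = (\<lambda>x. c *\<^sub>R f x)"

instance
  by standard (auto simp: scaleR_fun_def plus_fun_def fun_eq_iff
      scaleR_add_left scaleR_add_right)

end

section \<open>Real finite-dimensional Lie algebras and their Ricci operator\<close>

text \<open>
  A Lie algebra is a finite-dimensional subspace \<open>L\<close> of an ambient real vector space together
  with a bracket \<open>br\<close>. Brackets, inner products and operators are functions on the whole
  ambient type, but only their values on \<open>L\<close> are ever constrained or used.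
\<close>

definition linear_op_on :: "'a::real_vector set \<Rightarrow> ('a \<Rightarrow> 'a) \<Rightarrow> bool" where
  "linear_op_on L A \<longleftrightarrow>
     (\<forall>X\<in>L. A X \<in> L) \<and>
     (\<forall>X\<in>L. \<forall>Y\<in>L. A (X + Y) = A X + A Y) \<and>
     (\<forall>c. \<forall>X\<in>L. A (c *\<^sub>R X) = c *\<^sub>R A X)"

definition lie_algebra_on :: "'a::real_vector set \<Rightarrow> ('a \<Rightarrow> 'a \<Rightarrow> 'a) \<Rightarrow> bool" where
  "lie_algebra_on L br \<longleftrightarrow>
     (\<exists>B. finite B \<and> span B = L) \<and>
     (\<forall>X\<in>L. linear_op_on L (br X)) \<and>
     (\<forall>Y\<in>L. linear_op_on L (\<lambda>X. br X Y)) \<and>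
     (\<forall>X\<in>L. br X X = 0) \<and>
     (\<forall>X\<in>L. \<forall>Y\<in>L. \<forall>W\<in>L. br X (br Y W) + br Y (br W X) + br W (br X Y) = 0)"

definition inner_product_on :: "'a::real_vector set \<Rightarrow> ('a \<Rightarrow> 'a \<Rightarrow> real) \<Rightarrow> bool" where
  "inner_product_on L ip \<longleftrightarrow>
     (\<forall>X\<in>L. \<forall>Y\<in>L. ip X Y = ip Y X) \<and>
     (\<forall>X\<in>L. \<forall>Y\<in>L. \<forall>W\<in>L. ip (X + Y) W = ip X W + ip Y W) \<and>
     (\<forall>c. \<forall>X\<in>L. \<forall>Y\<in>L. ip (c *\<^sub>R X) Y = c * ip X Y) \<and>
     (\<forall>X\<in>L. X \<noteq> 0 \<longrightarrow> ip X X > 0)"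

definition orthonormal_basis_on :: "'a::real_vector set \<Rightarrow> ('a \<Rightarrow> 'a \<Rightarrow> real) \<Rightarrow> 'a set \<Rightarrow> bool" where
  "orthonormal_basis_on L ip E \<longleftrightarrow>
     finite E \<and> span E = L \<and> (\<forall>e\<in>E. \<forall>f\<in>E. ip e f = (if e = f then 1 else 0))"

text \<open>Trace of an endomorphism of \<open>L\<close>; the value does not depend on the basis chosen.\<close>

definition trace_on :: "'a::real_vector set \<Rightarrow> ('a \<Rightarrow> 'a) \<Rightarrow> real" where
  "trace_on L A =
     (let B = (SOME B. independent B \<and> span B = L) in \<Sum>b\<in>B. representation B (A b) b)"

definition symmetric_op_on :: "'a::real_vector set \<Rightarrow> ('a \<Rightarrow> 'a \<Rightarrow> real) \<Rightarrow> ('a \<Rightarrow> 'a) \<Rightarrow> bool" where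
  "symmetric_op_on L ip A \<longleftrightarrow>
     linear_op_on L A \<and> (\<forall>X\<in>L. \<forall>Y\<in>L. ip (A X) Y = ip X (A Y))"

text \<open>
  The operators below are picked by \<open>SOME\<close> rather than \<open>THE\<close>, since each is determined on \<open>L\<close>
  only. The adjoint is with respect to \<open>ip\<close>.
\<close>

definition adjoint_on :: "'a::real_vector set \<Rightarrow> ('a \<Rightarrow> 'a \<Rightarrow> real) \<Rightarrow> ('a \<Rightarrow> 'a) \<Rightarrow> 'a \<Rightarrow> 'a" where
  "adjoint_on L ip A =
     (SOME A'. linear_op_on L A' \<and> (\<forall>X\<in>L. \<forall>Y\<in>L. ip (A' X) Y = ip X (A Y)))"

definition sym_part_on :: "'a::real_vector set \<Rightarrow> ('a \<Rightarrow> 'a \<Rightarrow> real) \<Rightarrow> ('a \<Rightarrow> 'a) \<Rightarrow> 'a \<Rightarrow> 'a" where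
  "sym_part_on L ip A X = (1 / 2) *\<^sub>R (A X + adjoint_on L ip A X)"

definition mean_curvature_vector ::
  "'a::real_vector set \<Rightarrow> ('a \<Rightarrow> 'a \<Rightarrow> 'a) \<Rightarrow> ('a \<Rightarrow> 'a \<Rightarrow> real) \<Rightarrow> 'a" where
  "mean_curvature_vector L br ip =
     (THE H. H \<in> L \<and> (\<forall>X\<in>L. ip H X = trace_on L (br X)))"

definition killing_op ::
  "'a::real_vector set \<Rightarrow> ('a \<Rightarrow> 'a \<Rightarrow> 'a) \<Rightarrow> ('a \<Rightarrow> 'a \<Rightarrow> real) \<Rightarrow> 'a \<Rightarrow> 'a" where
  "killing_op L br ip =
     (SOME B. symmetric_op_on L ip B \<and>
        (\<forall>X\<in>L. ip (B X) X = trace_on L (br X \<circ> br X)))"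

definition moment_op ::
  "'a::real_vector set \<Rightarrow> ('a \<Rightarrow> 'a \<Rightarrow> 'a) \<Rightarrow> ('a \<Rightarrow> 'a \<Rightarrow> real) \<Rightarrow> 'a \<Rightarrow> 'a" where
  "moment_op L br ip =
     (SOME M. symmetric_op_on L ip M \<and>
        (\<forall>E. orthonormal_basis_on L ip E \<longrightarrow>
           (\<forall>X\<in>L. ip (M X) X =
              - (1 / 2) * (\<Sum>e\<in>E. \<Sum>f\<in>E. (ip (br X e) f)\<^sup>2)
              + (1 / 4) * (\<Sum>e\<in>E. \<Sum>f\<in>E. (ip (br e f) X)\<^sup>2))))"

definition ricci_op ::
  "'a::real_vector set \<Rightarrow> ('a \<Rightarrow> 'a \<Rightarrow> 'a) \<Rightarrow> ('a \<Rightarrow> 'a \<Rightarrow> real) \<Rightarrow> 'a \<Rightarrow> 'a" where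
  "ricci_op L br ip X =
     moment_op L br ip X - (1 / 2) *\<^sub>R killing_op L br ip X
     - sym_part_on L ip (br (mean_curvature_vector L br ip)) X"

definition negative_ricci ::
  "'a::real_vector set \<Rightarrow> ('a \<Rightarrow> 'a \<Rightarrow> 'a) \<Rightarrow> ('a \<Rightarrow> 'a \<Rightarrow> real) \<Rightarrow> bool" where
  "negative_ricci L br ip \<longleftrightarrow> (\<forall>X\<in>L. X \<noteq> 0 \<longrightarrow> ip (ricci_op L br ip X) X < 0)"

definition admits_negative_ricci :: "'a::real_vector set \<Rightarrow> ('a \<Rightarrow> 'a \<Rightarrow> 'a) \<Rightarrow> bool" where
  "admits_negative_ricci L br \<longleftrightarrow>
     lie_algebra_on L br \<and> (\<exists>ip. inner_product_on L ip \<and> negative_ricci L br ip)"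

section \<open>The compact matrix Lie algebras\<close>

definition ctranspose :: "complex^'n^'m \<Rightarrow> complex^'m^'n" where
  "ctranspose X = (\<chi> i j. cnj (X $ j $ i))"

definition skew_hermitian :: "(complex^'m^'m) set" where
  "skew_hermitian = {X. ctranspose X = - X}"

definition su :: "(complex^'m::finite^'m) set" where
  "su = {X \<in> skew_hermitian. trace X = 0}"

definition so :: "(complex^'m::finite^'m) set" where
  "so = {X. (\<forall>i j. X $ i $ j \<in> \<real>) \<and> transpose X = - X}"

text \<open>
  \<open>\<complex>\<^sup>2\<^sup>m\<close> is indexed by \<open>'m + 'm\<close>, and \<open>symp_form\<close> is the block matrix with blocks
  \<open>0, 1, -1, 0\<close>.
\<close>

definition symp_form :: "complex^('m::finite + 'm)^('m + 'm)" where
  "symp_form = (\<chi> i j. case (i, j) of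
       (Inl a, Inr b) \<Rightarrow> (if a = b then 1 else 0)
     | (Inr a, Inl b) \<Rightarrow> (if a = b then -1 else 0)
     | _ \<Rightarrow> 0)"

definition sp_complex :: "(complex^('m::finite + 'm)^('m + 'm)) set" where
  "sp_complex = {X. transpose X ** symp_form + symp_form ** X = 0}"

definition sp :: "(complex^('m::finite + 'm)^('m + 'm)) set" where
  "sp = sp_complex \<inter> skew_hermitian"

section \<open>The standard representation and the extended Lie algebra\<close>

text \<open>
  Homogeneous polynomials are represented by the functions they induce on \<open>\<complex>\<^sup>r\<close>;
  \<open>\<alpha>\<close> ranges over the multi-indices of total degree \<open>n\<close>.
\<close>

definition homog_polys :: "nat \<Rightarrow> (complex^'r::finite \<Rightarrow> complex) set" where
  "homog_polys n =
     {P. \<exists>c. P = (\<lambda>z. \<Sum>\<alpha> | (\<Sum>i\<in>UNIV. \<alpha> i) = n. c \<alpha> * (\<Prod>i\<in>UNIV. (z $ i) ^ \<alpha> i))}"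

text \<open>Matrix exponential; \<open>((**) X ^^ k) (mat 1)\<close> is the \<open>k\<close>-th matrix power of \<open>X\<close>.\<close>

definition mexp :: "complex^'r::finite^'r \<Rightarrow> complex^'r^'r" where
  "mexp X = (\<Sum>k. (1 / fact k) *\<^sub>R ((**) X ^^ k) (mat 1))"

definition std_rep ::
  "complex^'r::finite^'r \<Rightarrow> (complex^'r \<Rightarrow> complex) \<Rightarrow> complex^'r \<Rightarrow> complex" where
  "std_rep X P z = vector_derivative (\<lambda>t::real. P (mexp ((- t) *\<^sub>R X) *v z)) (at 0)"

text \<open>
  The triple \<open>(a, X, P)\<close> stands for \<open>a Z + X + P\<close> in \<open>(\<real>Z \<oplus> \<uu>) \<ltimes> \<P>\<^sub>n(\<complex>\<^sup>r)\<close>.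
\<close>

type_synonym 'r ext = "real \<times> (complex^'r^'r) \<times> (complex^'r \<Rightarrow> complex)"

definition ext_carrier :: "(complex^'r::finite^'r) set \<Rightarrow> nat \<Rightarrow> 'r ext set" where
  "ext_carrier \<uu> n = UNIV \<times> \<uu> \<times> homog_polys n"

fun ext_bracket :: "'r::finite ext \<Rightarrow> 'r ext \<Rightarrow> 'r ext" where
  "ext_bracket (a, X, P) (b, Y, Q) =
     (0, X ** Y - Y ** X, (a *\<^sub>R Q + std_rep X Q) - (b *\<^sub>R P + std_rep Y P))"

end

theory Submission
  imports Defs
begin

text \<open>
  Choose an inner product on \<open>\<l>\<close> for which \<open>\<real>Z\<close>, \<open>\<uu>\<close> and \<open>V\<close> are orthogonal, with \<open>|Z| = \<epsilon>\<close> and with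
  \<open>\<langle>X, Y\<rangle> = Re tr (X Y\<^sup>*)\<close> on \<open>\<uu>\<close>. The latter is \<open>ad\<close>-invariant because \<open>\<uu>\<close> consists of skew-Hermitian
  matrices. Every \<open>ad U\<close> with \<open>U \<in> \<uu>\<close> is traceless, on \<open>\<uu>\<close> by this invariance and on \<open>V\<close> because the
  diagonal of \<open>U\<close> is imaginary (\<open>mono_coord_diagonal\<close>). So the mean curvature vector is
  \<open>H = (dim V / \<epsilon>\<^sup>2) Z\<close>, and for every inner product on \<open>V\<close> the Ricci form splits into a term for each
  summand (\<open>ricci_ip\<close>): its value at \<open>a Z + U + P\<close> is the sum of

  \<^item> \<open>- a\<^sup>2 dim V\<close>,
  \<^item> \<open>1/4 \<Sum>\<^sub>e |[U, e]|\<^sup>2 - 1/2 (tr \<pi>(U)\<^sup>2 + |\<pi>(U)|\<^sup>2)\<close>,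
  \<^item> \<open>1/2 \<Sum>\<^sub>e \<Sum>\<^sub>v \<langle>\<pi>(e) v, P\<rangle>\<^sup>2 - 1/2 \<Sum>\<^sub>e |\<pi>(e) P|\<^sup>2 - (dim V / \<epsilon>\<^sup>2) |P|\<^sup>2\<close>,

  where \<open>e\<close> and \<open>v\<close> run through orthonormal bases of \<open>\<uu>\<close> and \<open>V\<close>. The last term is negative once \<open>\<epsilon>\<close>
  is small, whatever the inner product on \<open>V\<close> is. So everything depends on the middle term
  (\<open>admits_negative_ricci\<close>), where the inner product on \<open>V\<close> is still free: \<open>tr \<pi>(U)\<^sup>2\<close> does not depend
  on it, but the Hilbert-Schmidt norm \<open>|\<pi>(U)|\<close> does and can be made as large as desired.

  Indeed, let the real basis of all \<open>z\<^sup>\<alpha>\<close> and \<open>\<i> z\<^sup>\<alpha>\<close> be orthogonal, the pure powers \<open>z\<^sub>i\<^sup>n\<close> having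
  norm 1 and all other basis vectors norm \<open>s\<close>. Then
  \<open>\<pi>(U) z\<^sub>i\<^sup>n = - n \<Sum>\<^sub>j U\<^sub>i\<^sub>j z\<^sub>j z\<^sub>i\<^sup>n\<^sup>-\<^sup>1\<close>. For \<open>j \<noteq> i\<close> the monomial \<open>z\<^sub>j z\<^sub>i\<^sup>n\<^sup>-\<^sup>1\<close> is not a pure power, since
  \<open>n \<ge> 2\<close>; for \<open>j = i\<close> the coefficient \<open>U\<^sub>i\<^sub>i\<close> is purely imaginary. So only basis vectors of norm \<open>s\<close>
  occur on the right, and summing over \<open>i\<close> gives \<open>|\<pi>(U)|\<^sup>2 \<ge> s\<^sup>2 |U|\<^sup>2\<close>
  (\<open>weighted_norm_lower_bound\<close>). For large \<open>s\<close> this exceeds the remaining parts of the middle term,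
  which are quadratic forms in \<open>U\<close> independent of \<open>s\<close>. The argument applies to every Lie algebra of
  skew-Hermitian matrices (\<open>skew_hermitian_admits_negative_ricci\<close>).
\<close>

section \<open>The Ricci form in an orthonormal basis\<close>

text \<open>
  Inner products, operators and brackets are only meaningful on the carrier, so the elementary
  facts about them are collected in a locale that fixes one orthonormal basis \<open>E\<close>.
\<close>

locale orthonormal_frame =
  fixes L :: "'a::real_vector set" and ip :: "'a \<Rightarrow> 'a \<Rightarrow> real" and E :: "'a set"
  assumes inner_product: "inner_product_on L ip"
    and orthonormal: "orthonormal_basis_on L ip E"
begin

lemma finite_frame: "finite E" and span_frame: "span E = L"
  and ip_frame: "e \<in> E \<Longrightarrow> f \<in> E \<Longrightarrow> ip e f = (if e = f then 1 else 0)"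
  using orthonormal by (auto simp: orthonormal_basis_on_def)

lemma subspace_carrier: "subspace L"
  using span_frame subspace_span by metis

lemma frame_in: "e \<in> E \<Longrightarrow> e \<in> L"
  using span_frame span_base by metis

lemma zero_in: "0 \<in> L"
  and add_in: "X \<in> L \<Longrightarrow> Y \<in> L \<Longrightarrow> X + Y \<in> L"
  and scaleR_in: "X \<in> L \<Longrightarrow> c *\<^sub>R X \<in> L"
  using subspace_carrier by (auto simp: subspace_def)

lemma sum_in: "(\<And>i. i \<in> I \<Longrightarrow> f i \<in> L) \<Longrightarrow> (\<Sum>i\<in>I. f i) \<in> L"
  using subspace_carrier by (rule subspace_sum)

lemma ip_commute: "X \<in> L \<Longrightarrow> Y \<in> L \<Longrightarrow> ip X Y = ip Y X"
  and ip_add_left: "X \<in> L \<Longrightarrow> Y \<in> L \<Longrightarrow> W \<in> L \<Longrightarrow> ip (X + Y) W = ip X W + ip Y W"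
  and ip_scaleR_left: "X \<in> L \<Longrightarrow> Y \<in> L \<Longrightarrow> ip (c *\<^sub>R X) Y = c * ip X Y"
  and ip_pos: "X \<in> L \<Longrightarrow> X \<noteq> 0 \<Longrightarrow> ip X X > 0"
proof -
  note ip = inner_product[unfolded inner_product_on_def]
  show "X \<in> L \<Longrightarrow> Y \<in> L \<Longrightarrow> ip X Y = ip Y X"
    by (rule ip[THEN conjunct1, rule_format])
  show "X \<in> L \<Longrightarrow> Y \<in> L \<Longrightarrow> W \<in> L \<Longrightarrow> ip (X + Y) W = ip X W + ip Y W"
    using ip[THEN conjunct2, THEN conjunct1] by simp
  show "X \<in> L \<Longrightarrow> Y \<in> L \<Longrightarrow> ip (c *\<^sub>R X) Y = c * ip X Y"
    using ip[THEN conjunct2, THEN conjunct2, THEN conjunct1] by simp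
  show "X \<in> L \<Longrightarrow> X \<noteq> 0 \<Longrightarrow> ip X X > 0"
    using ip[THEN conjunct2, THEN conjunct2, THEN conjunct2] by simp
qed

lemma ip_add_right: "X \<in> L \<Longrightarrow> Y \<in> L \<Longrightarrow> W \<in> L \<Longrightarrow> ip W (X + Y) = ip W X + ip W Y"
  using ip_commute[of W "X + Y"] ip_commute[of W X] ip_commute[of W Y] ip_add_left add_in by simp

lemma ip_scaleR_right: "X \<in> L \<Longrightarrow> Y \<in> L \<Longrightarrow> ip Y (c *\<^sub>R X) = c * ip Y X"
  using ip_commute[of Y "c *\<^sub>R X"] ip_commute[of Y X] ip_scaleR_left scaleR_in by simp

lemma ip_zero_left: "X \<in> L \<Longrightarrow> ip 0 X = 0"
  using ip_scaleR_left[of 0 X 0] zero_in by simp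

lemma ip_zero_right: "X \<in> L \<Longrightarrow> ip X 0 = 0"
  using ip_scaleR_right[of 0 X 0] zero_in by simp

lemma ip_minus_left: "X \<in> L \<Longrightarrow> Y \<in> L \<Longrightarrow> ip (- X) Y = - ip X Y"
  using ip_scaleR_left[of X Y "-1"] by simp

lemma ip_minus_right: "X \<in> L \<Longrightarrow> Y \<in> L \<Longrightarrow> ip X (- Y) = - ip X Y"
  using ip_scaleR_right[of Y X "-1"] by simp

lemma minus_in: "X \<in> L \<Longrightarrow> - X \<in> L"
  using scaleR_in[of X "-1"] by simp

lemma ip_diff_left: "X \<in> L \<Longrightarrow> Y \<in> L \<Longrightarrow> W \<in> L \<Longrightarrow> ip (X - Y) W = ip X W - ip Y W"
  using ip_add_left[of X "- Y" W] minus_in by (simp add: ip_minus_left)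

lemma ip_sum_left:
  assumes "\<And>i. i \<in> I \<Longrightarrow> f i \<in> L" and "Y \<in> L"
  shows "ip (\<Sum>i\<in>I. f i) Y = (\<Sum>i\<in>I. ip (f i) Y)"
  using assms
  by (induction I rule: infinite_finite_induct) (simp_all add: ip_zero_left ip_add_left sum_in)

lemma ip_nonneg: "X \<in> L \<Longrightarrow> ip X X \<ge> 0"
  using ip_pos[of X] ip_zero_left[of 0] zero_in by (cases "X = 0") auto

lemma frame_expansion:
  assumes "X \<in> L"
  shows "X = (\<Sum>e\<in>E. ip X e *\<^sub>R e)"
proof -
  obtain c where c: "X = (\<Sum>e\<in>E. c e *\<^sub>R e)"
    using assms unfolding span_frame[symmetric] span_finite[OF finite_frame] by (elim imageE)
  have "ip X f = c f" if f: "f \<in> E" for f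
  proof -
    have "ip X f = (\<Sum>e\<in>E. ip (c e *\<^sub>R e) f)"
      unfolding c using f by (intro ip_sum_left) (auto intro: frame_in scaleR_in)
    also have "\<dots> = (\<Sum>e\<in>E. if e = f then c e else 0)"
      by (intro sum.cong refl) (simp add: ip_scaleR_left frame_in f ip_frame)
    finally show ?thesis using f finite_frame by simp
  qed
  then show ?thesis using c by simp
qed

lemma parseval:
  assumes "X \<in> L" "Y \<in> L"
  shows "ip X Y = (\<Sum>e\<in>E. ip X e * ip Y e)"
proof -
  have "ip X Y = ip (\<Sum>e\<in>E. ip X e *\<^sub>R e) Y"
    using frame_expansion[OF assms(1)] by simp
  also have "\<dots> = (\<Sum>e\<in>E. ip (ip X e *\<^sub>R e) Y)"
    using assms by (intro ip_sum_left) (auto intro: frame_in scaleR_in)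
  also have "\<dots> = (\<Sum>e\<in>E. ip X e * ip Y e)"
    by (intro sum.cong refl) (simp add: ip_scaleR_left frame_in assms ip_commute)
  finally show ?thesis .
qed

lemma parseval_square: "X \<in> L \<Longrightarrow> (\<Sum>e\<in>E. (ip X e)\<^sup>2) = ip X X"
  by (simp add: parseval[of X X] power2_eq_square)

lemma cauchy_schwarz:
  assumes "X \<in> L" "Y \<in> L"
  shows "(ip X Y)\<^sup>2 \<le> ip X X * ip Y Y"
  unfolding parseval[OF assms] parseval_square[OF assms(1), symmetric]
    parseval_square[OF assms(2), symmetric]
  by (rule Cauchy_Schwarz_ineq_sum)

lemma functional_expansion:
  assumes "\<And>Y Z. Y \<in> L \<Longrightarrow> Z \<in> L \<Longrightarrow> \<phi> (Y + Z) = \<phi> Y + (\<phi> Z :: real)"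
    and "\<And>c Y. Y \<in> L \<Longrightarrow> \<phi> (c *\<^sub>R Y) = c * \<phi> Y"
    and "X \<in> L"
  shows "\<phi> X = (\<Sum>e\<in>E. ip X e * \<phi> e)"
proof -
  have sum: "\<phi> (\<Sum>i\<in>I. g i) = (\<Sum>i\<in>I. \<phi> (g i))" if "finite I" "\<And>i. i \<in> I \<Longrightarrow> g i \<in> L" for I and g :: "'a \<Rightarrow> 'a"
    using that
  proof (induction I rule: finite_induct)
    case empty
    show ?case using assms(2)[of 0 0] zero_in by simp
  qed (simp add: assms(1) sum_in)
  have "\<phi> X = \<phi> (\<Sum>e\<in>E. ip X e *\<^sub>R e)"
    using frame_expansion[OF assms(3)] by simp
  also have "\<dots> = (\<Sum>e\<in>E. \<phi> (ip X e *\<^sub>R e))"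
    using finite_frame by (intro sum) (auto intro: frame_in scaleR_in)
  also have "\<dots> = (\<Sum>e\<in>E. ip X e * \<phi> e)"
    by (intro sum.cong refl) (simp add: assms(2) frame_in)
  finally show ?thesis .
qed

text \<open>
  The sum is the squared norm of the vector that represents \<open>\<phi>\<close>.
\<close>

lemma functional_square_sum_frame_independent:
  assumes F: "orthonormal_basis_on L ip F"
    and add: "\<And>Y Z. Y \<in> L \<Longrightarrow> Z \<in> L \<Longrightarrow> \<phi> (Y + Z) = \<phi> Y + (\<phi> Z :: real)"
    and scale: "\<And>c Y. Y \<in> L \<Longrightarrow> \<phi> (c *\<^sub>R Y) = c * \<phi> Y"
  shows "(\<Sum>f\<in>F. (\<phi> f)\<^sup>2) = (\<Sum>e\<in>E. (\<phi> e)\<^sup>2)"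
proof -
  interpret F: orthonormal_frame L ip F
    using inner_product F by unfold_locales
  define v where "v = (\<Sum>e\<in>E. \<phi> e *\<^sub>R e)"
  have v: "v \<in> L" unfolding v_def by (intro sum_in scaleR_in frame_in)
  have \<phi>: "\<phi> Y = ip v Y" if "Y \<in> L" for Y
  proof -
    have "ip v Y = (\<Sum>e\<in>E. ip (\<phi> e *\<^sub>R e) Y)"
      unfolding v_def using that by (intro ip_sum_left) (auto intro: frame_in scaleR_in)
    also have "\<dots> = (\<Sum>e\<in>E. ip Y e * \<phi> e)"
      by (intro sum.cong refl) (simp add: ip_scaleR_left frame_in that ip_commute)
    also have "\<dots> = \<phi> Y" using functional_expansion[OF add scale that] by simp
    finally show ?thesis by simp
  qed
  have "(\<Sum>f\<in>F. (\<phi> f)\<^sup>2) = (\<Sum>f\<in>F. (ip v f)\<^sup>2)" by (simp add: \<phi> F.frame_in)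
  also have "\<dots> = ip v v" by (rule F.parseval_square[OF v])
  also have "\<dots> = (\<Sum>e\<in>E. (ip v e)\<^sup>2)" using parseval_square[OF v] by simp
  also have "\<dots> = (\<Sum>e\<in>E. (\<phi> e)\<^sup>2)" by (simp add: \<phi> frame_in)
  finally show ?thesis .
qed

text \<open>
  The defining condition of the moment operator ranges over all orthonormal bases at once. It can be
  met only because the two double sums in it have the same value for each of them: replace the basis
  in one argument of \<open>\<beta>\<close> at a time.
\<close>

lemma bilinear_square_sum_frame_independent:
  assumes F: "orthonormal_basis_on L ip F"
    and "\<And>X Y Z. X \<in> L \<Longrightarrow> Y \<in> L \<Longrightarrow> Z \<in> L \<Longrightarrow> \<beta> (X + Y) Z = \<beta> X Z + (\<beta> Y Z :: real)"
    and "\<And>c X Y. X \<in> L \<Longrightarrow> Y \<in> L \<Longrightarrow> \<beta> (c *\<^sub>R X) Y = c * \<beta> X Y"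
    and "\<And>X Y Z. X \<in> L \<Longrightarrow> Y \<in> L \<Longrightarrow> Z \<in> L \<Longrightarrow> \<beta> X (Y + Z) = \<beta> X Y + \<beta> X Z"
    and "\<And>c X Y. X \<in> L \<Longrightarrow> Y \<in> L \<Longrightarrow> \<beta> X (c *\<^sub>R Y) = c * \<beta> X Y"
  shows "(\<Sum>e\<in>F. \<Sum>f\<in>F. (\<beta> e f)\<^sup>2) = (\<Sum>e\<in>E. \<Sum>f\<in>E. (\<beta> e f)\<^sup>2)"
proof -
  interpret F: orthonormal_frame L ip F
    using inner_product F by unfold_locales
  have "(\<Sum>e\<in>F. \<Sum>f\<in>F. (\<beta> e f)\<^sup>2) = (\<Sum>e\<in>F. \<Sum>f\<in>E. (\<beta> e f)\<^sup>2)"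
    by (intro sum.cong refl functional_square_sum_frame_independent F) (auto simp: assms F.frame_in)
  also have "\<dots> = (\<Sum>f\<in>E. \<Sum>e\<in>F. (\<beta> e f)\<^sup>2)" by (rule sum.swap)
  also have "\<dots> = (\<Sum>f\<in>E. \<Sum>e\<in>E. (\<beta> e f)\<^sup>2)"
    by (intro sum.cong refl functional_square_sum_frame_independent F) (auto simp: assms frame_in)
  also have "\<dots> = (\<Sum>e\<in>E. \<Sum>f\<in>E. (\<beta> e f)\<^sup>2)" by (rule sum.swap)
  finally show ?thesis .
qed

text \<open>
  Expanding \<open>A b\<close> in the frame and the frame vectors in the basis \<open>B\<close> that defines the trace turns
  either sum into the double sum of \<open>ip (A b) e\<close> times the \<open>b\<close>-coordinate of \<open>e\<close>.
\<close>

lemma trace_on_frame: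
  assumes "linear_op_on L A"
  shows "trace_on L A = (\<Sum>e\<in>E. ip (A e) e)"
proof -
  define B where "B = (SOME B. independent B \<and> span B = L)"
  have "\<exists>B. independent B \<and> span B = L"
    using basis_exists[of L] span_minimal[OF _ subspace_carrier] by (metis subset_antisym)
  then have B: "independent B" "span B = L"
    unfolding B_def by (metis (mono_tags, lifting) someI_ex)+
  have finB: "finite B"
    using independent_span_bound[OF finite_frame B(1)] B(2) span_frame span_superset by blast
  have B_in: "b \<in> L" if "b \<in> B" for b using B(2) span_base that by metis
  have A_in: "A X \<in> L" if "X \<in> L" for X
    using assms that unfolding linear_op_on_def by blast
  have A_lin: "ip (A X) e = (\<Sum>b\<in>B. representation B X b * ip (A b) e)" if X: "X \<in> L" and e: "e \<in> L" for X e
  proof -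
    have sumA: "A (\<Sum>i\<in>I. g i) = (\<Sum>i\<in>I. A (g i))" if "finite I" "\<And>i. i \<in> I \<Longrightarrow> g i \<in> L"
      for I and g :: "'a \<Rightarrow> 'a"
      using that
    proof (induction I rule: finite_induct)
      case empty
      have "A (0 *\<^sub>R 0) = 0 *\<^sub>R A 0" using assms zero_in unfolding linear_op_on_def by blast
      then show ?case by simp
    next
      case (insert i I)
      then show ?case using assms sum_in[of I g] unfolding linear_op_on_def by simp
    qed
    have "X = (\<Sum>b\<in>B. representation B X b *\<^sub>R b)"
      using sum_representation_eq[OF B(1) _ finB subset_refl] X B(2) by simp
    then have "A X = (\<Sum>b\<in>B. A (representation B X b *\<^sub>R b))"
      using sumA[OF finB, of "\<lambda>b. representation B X b *\<^sub>R b"] by (simp add: B_in scaleR_in)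
    also have "\<dots> = (\<Sum>b\<in>B. representation B X b *\<^sub>R A b)"
      using assms B_in unfolding linear_op_on_def by (intro sum.cong) auto
    finally show ?thesis using e
      by (simp add: ip_sum_left A_in B_in scaleR_in ip_scaleR_left)
  qed
  have "trace_on L A = (\<Sum>b\<in>B. representation B (A b) b)"
    unfolding trace_on_def B_def[symmetric] Let_def ..
  also have "\<dots> = (\<Sum>b\<in>B. \<Sum>e\<in>E. ip (A b) e * representation B e b)"
  proof (intro sum.cong refl)
    fix b assume b: "b \<in> B"
    have "representation B (A b) b = representation B (\<Sum>e\<in>E. ip (A b) e *\<^sub>R e) b"
      using frame_expansion[OF A_in[OF B_in[OF b]]] by simp
    also have "\<dots> = (\<Sum>e\<in>E. representation B (ip (A b) e *\<^sub>R e) b)"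
      by (subst representation_sum[OF B(1)]) (auto simp: B(2) frame_in scaleR_in)
    also have "\<dots> = (\<Sum>e\<in>E. ip (A b) e * representation B e b)"
      by (intro sum.cong refl) (simp add: representation_scale[OF B(1)] B(2) frame_in)
    finally show "representation B (A b) b = (\<Sum>e\<in>E. ip (A b) e * representation B e b)" .
  qed
  also have "\<dots> = (\<Sum>e\<in>E. \<Sum>b\<in>B. representation B e b * ip (A b) e)"
    by (subst sum.swap) (simp add: mult.commute)
  also have "\<dots> = (\<Sum>e\<in>E. ip (A e) e)"
    by (intro sum.cong refl) (simp add: A_lin[symmetric] frame_in)
  finally show ?thesis .
qed

text \<open>
  Riesz representation. The adjoint, the Killing operator and the moment operator all exist by this
  lemma, which is what makes the choices in their definitions meaningful.
\<close>

lemma operator_of_bilinear_form: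
  assumes add: "\<And>X Y Z. X \<in> L \<Longrightarrow> Y \<in> L \<Longrightarrow> Z \<in> L \<Longrightarrow> \<beta> (X + Y) Z = \<beta> X Z + (\<beta> Y Z :: real)"
    and scale: "\<And>c X Y. X \<in> L \<Longrightarrow> Y \<in> L \<Longrightarrow> \<beta> (c *\<^sub>R X) Y = c * \<beta> X Y"
    and add': "\<And>X Y Z. X \<in> L \<Longrightarrow> Y \<in> L \<Longrightarrow> Z \<in> L \<Longrightarrow> \<beta> X (Y + Z) = \<beta> X Y + \<beta> X Z"
    and scale': "\<And>c X Y. X \<in> L \<Longrightarrow> Y \<in> L \<Longrightarrow> \<beta> X (c *\<^sub>R Y) = c * \<beta> X Y"
  obtains A where "linear_op_on L A" "\<And>X Y. X \<in> L \<Longrightarrow> Y \<in> L \<Longrightarrow> ip (A X) Y = \<beta> X Y"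
proof
  let ?A = "\<lambda>X. \<Sum>e\<in>E. \<beta> X e *\<^sub>R e"
  show "linear_op_on L ?A"
    unfolding linear_op_on_def
    by (auto simp: add scale frame_in sum.distrib[symmetric] scaleR_add_left scaleR_sum_right
        intro!: sum_in scaleR_in sum.cong)
  fix X Y assume X: "X \<in> L" and Y: "Y \<in> L"
  have "ip (?A X) Y = (\<Sum>e\<in>E. ip (\<beta> X e *\<^sub>R e) Y)"
    using Y by (intro ip_sum_left) (auto intro: frame_in scaleR_in)
  also have "\<dots> = (\<Sum>e\<in>E. ip Y e * \<beta> X e)"
    by (intro sum.cong refl) (simp add: ip_scaleR_left frame_in Y ip_commute)
  also have "\<dots> = \<beta> X Y"
    using functional_expansion[of "\<beta> X" Y] X Y add' scale' by simp
  finally show "ip (?A X) Y = \<beta> X Y" .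
qed

lemma sym_part_quadratic:
  assumes A: "linear_op_on L A" and X: "X \<in> L"
  shows "ip (sym_part_on L ip A X) X = ip (A X) X"
proof -
  have A_in: "A X \<in> L" if "X \<in> L" for X
    using A that unfolding linear_op_on_def by blast
  obtain A' where "linear_op_on L A'" "\<And>X Y. X \<in> L \<Longrightarrow> Y \<in> L \<Longrightarrow> ip (A' X) Y = ip X (A Y)"
  proof (rule operator_of_bilinear_form[of "\<lambda>X Y. ip X (A Y)"])
    show "ip X (A (Y + Z)) = ip X (A Y) + ip X (A Z)" if "X \<in> L" "Y \<in> L" "Z \<in> L" for X Y Z
      using A that ip_add_right A_in unfolding linear_op_on_def by simp
    show "ip X (A (c *\<^sub>R Y)) = c * ip X (A Y)" if "X \<in> L" "Y \<in> L" for c X Y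
      using A that ip_scaleR_right A_in unfolding linear_op_on_def by simp
  qed (auto simp: ip_add_left ip_scaleR_left A_in)
  then have ex: "\<exists>A'. linear_op_on L A' \<and> (\<forall>X\<in>L. \<forall>Y\<in>L. ip (A' X) Y = ip X (A Y))" by blast
  have "linear_op_on L (adjoint_on L ip A) \<and>
      (\<forall>X\<in>L. \<forall>Y\<in>L. ip (adjoint_on L ip A X) Y = ip X (A Y))"
    unfolding adjoint_on_def by (rule someI_ex[OF ex])
  then have "adjoint_on L ip A X \<in> L" "ip (adjoint_on L ip A X) X = ip X (A X)"
    using X unfolding linear_op_on_def by blast+
  then show ?thesis
    using A_in[OF X] X
    by (simp add: sym_part_on_def ip_scaleR_left ip_add_left add_in ip_commute[of X "A X"])
qed

end

text \<open>
  The Ricci form involves three operators given by choice; their quadratic forms are the only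
  information needed, and these are determined by the conditions that the choices satisfy.
\<close>

locale metric_lie_algebra = orthonormal_frame L ip E
  for L :: "'a::real_vector set" and ip E +
  fixes br :: "'a \<Rightarrow> 'a \<Rightarrow> 'a"
  assumes lie_algebra: "lie_algebra_on L br"
begin

lemma br_in: "X \<in> L \<Longrightarrow> Y \<in> L \<Longrightarrow> br X Y \<in> L"
  and br_add_right: "X \<in> L \<Longrightarrow> Y \<in> L \<Longrightarrow> Z \<in> L \<Longrightarrow> br X (Y + Z) = br X Y + br X Z"
  and br_scaleR_right: "X \<in> L \<Longrightarrow> Y \<in> L \<Longrightarrow> br X (c *\<^sub>R Y) = c *\<^sub>R br X Y"
  and br_add_left: "X \<in> L \<Longrightarrow> Y \<in> L \<Longrightarrow> Z \<in> L \<Longrightarrow> br (X + Y) Z = br X Z + br Y Z"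
  and br_scaleR_left: "X \<in> L \<Longrightarrow> Y \<in> L \<Longrightarrow> br (c *\<^sub>R X) Y = c *\<^sub>R br X Y"
  using lie_algebra unfolding lie_algebra_on_def linear_op_on_def by simp_all

lemma linear_br: "X \<in> L \<Longrightarrow> linear_op_on L (br X)"
  using lie_algebra unfolding lie_algebra_on_def by blast

lemma moment_quadratic:
  assumes X: "X \<in> L"
  shows "moment_op L br ip X \<in> L"
    and "ip (moment_op L br ip X) X =
      - (1 / 2) * (\<Sum>e\<in>E. \<Sum>f\<in>E. (ip (br X e) f)\<^sup>2)
      + (1 / 4) * (\<Sum>e\<in>E. \<Sum>f\<in>E. (ip (br e f) X)\<^sup>2)"
proof -
  \<comment> \<open>The polarization of the quadratic form that defines the operator.\<close>
  let ?\<beta> = "\<lambda>X Y. - (1 / 2) * (\<Sum>e\<in>E. \<Sum>f\<in>E. ip (br X e) f * ip (br Y e) f)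
      + (1 / 4) * (\<Sum>e\<in>E. \<Sum>f\<in>E. ip (br e f) X * ip (br e f) Y)"
  obtain M where M: "linear_op_on L M" "\<And>X Y. X \<in> L \<Longrightarrow> Y \<in> L \<Longrightarrow> ip (M X) Y = ?\<beta> X Y"
    by (rule operator_of_bilinear_form[of ?\<beta>])
      (simp_all add: br_in br_add_left br_scaleR_left ip_add_left ip_scaleR_left ip_add_right
        ip_scaleR_right frame_in algebra_simps sum.distrib sum_distrib_left)
  have "symmetric_op_on L ip M"
    unfolding symmetric_op_on_def
  proof (intro conjI ballI M)
    fix X Y assume "X \<in> L" "Y \<in> L"
    moreover have "M Y \<in> L" using M(1) \<open>Y \<in> L\<close> unfolding linear_op_on_def by blast
    ultimately show "ip (M X) Y = ip X (M Y)"
      by (simp add: ip_commute[of X "M Y"] M(2) mult.commute)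
  qed
  moreover have "ip (M X) X = - (1 / 2) * (\<Sum>e\<in>F. \<Sum>f\<in>F. (ip (br X e) f)\<^sup>2)
      + (1 / 4) * (\<Sum>e\<in>F. \<Sum>f\<in>F. (ip (br e f) X)\<^sup>2)"
    if F: "orthonormal_basis_on L ip F" and X: "X \<in> L" for F X
  proof -
    have "(\<Sum>e\<in>F. \<Sum>f\<in>F. (ip (br X e) f)\<^sup>2) = (\<Sum>e\<in>E. \<Sum>f\<in>E. (ip (br X e) f)\<^sup>2)"
      by (rule bilinear_square_sum_frame_independent[OF F])
        (simp_all add: X br_in br_add_right br_scaleR_right ip_add_left ip_scaleR_left ip_add_right
          ip_scaleR_right)
    moreover have "(\<Sum>e\<in>F. \<Sum>f\<in>F. (ip (br e f) X)\<^sup>2) = (\<Sum>e\<in>E. \<Sum>f\<in>E. (ip (br e f) X)\<^sup>2)"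
      by (rule bilinear_square_sum_frame_independent[OF F])
        (simp_all add: X br_in br_add_right br_scaleR_right br_add_left br_scaleR_left
          ip_add_left ip_scaleR_left)
    ultimately show ?thesis using M(2)[OF X X] by (simp add: power2_eq_square)
  qed
  ultimately have ex: "\<exists>M. symmetric_op_on L ip M \<and>
        (\<forall>F. orthonormal_basis_on L ip F \<longrightarrow>
           (\<forall>X\<in>L. ip (M X) X =
              - (1 / 2) * (\<Sum>e\<in>F. \<Sum>f\<in>F. (ip (br X e) f)\<^sup>2)
              + (1 / 4) * (\<Sum>e\<in>F. \<Sum>f\<in>F. (ip (br e f) X)\<^sup>2)))"
    by blast
  note op = someI_ex[OF ex, folded moment_op_def]
  show "moment_op L br ip X \<in> L"
    using op X unfolding symmetric_op_on_def linear_op_on_def by blast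
  show "ip (moment_op L br ip X) X =
      - (1 / 2) * (\<Sum>e\<in>E. \<Sum>f\<in>E. (ip (br X e) f)\<^sup>2)
      + (1 / 4) * (\<Sum>e\<in>E. \<Sum>f\<in>E. (ip (br e f) X)\<^sup>2)"
    using op X orthonormal by blast
qed

lemma killing_quadratic:
  assumes X: "X \<in> L"
  shows "killing_op L br ip X \<in> L"
    and "ip (killing_op L br ip X) X = (\<Sum>e\<in>E. ip (br X (br X e)) e)"
proof -
  have tr: "trace_on L (br X \<circ> br X) = (\<Sum>e\<in>E. ip (br X (br X e)) e)" if "X \<in> L" for X
  proof -
    have "linear_op_on L (br X \<circ> br X)"
      unfolding linear_op_on_def using that by (simp add: br_in br_add_right br_scaleR_right)
    from trace_on_frame[OF this] show ?thesis by simp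
  qed
  \<comment> \<open>Writing the trace form in this way makes its symmetry evident.\<close>
  let ?\<beta> = "\<lambda>X Y. (1 / 2) * (\<Sum>e\<in>E. ip (br X (br Y e)) e + ip (br Y (br X e)) e)"
  obtain M where M: "linear_op_on L M" "\<And>X Y. X \<in> L \<Longrightarrow> Y \<in> L \<Longrightarrow> ip (M X) Y = ?\<beta> X Y"
    by (rule operator_of_bilinear_form[of ?\<beta>])
      (simp_all add: br_in br_add_left br_scaleR_left br_add_right br_scaleR_right
        ip_add_left ip_scaleR_left frame_in algebra_simps sum.distrib sum_distrib_left)
  have "symmetric_op_on L ip M"
    unfolding symmetric_op_on_def
  proof (intro conjI ballI M)
    fix X Y assume "X \<in> L" "Y \<in> L"
    moreover have "M Y \<in> L" using M(1) \<open>Y \<in> L\<close> unfolding linear_op_on_def by blast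
    ultimately show "ip (M X) Y = ip X (M Y)"
      by (simp add: ip_commute[of X "M Y"] M(2) add.commute)
  qed
  moreover have "ip (M X) X = trace_on L (br X \<circ> br X)" if "X \<in> L" for X
    using that by (simp add: M(2) tr sum_distrib_left[symmetric])
  ultimately have ex: "\<exists>M. symmetric_op_on L ip M \<and>
      (\<forall>X\<in>L. ip (M X) X = trace_on L (br X \<circ> br X))"
    by blast
  note op = someI_ex[OF ex, folded killing_op_def]
  show "killing_op L br ip X \<in> L"
    using op X unfolding symmetric_op_on_def linear_op_on_def by blast
  show "ip (killing_op L br ip X) X = (\<Sum>e\<in>E. ip (br X (br X e)) e)"
    using op X tr by simp
qed

text \<open>
  Positive definiteness gives uniqueness, so exhibiting one candidate determines the vector.
\<close>

lemma mean_curvature_eqI: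
  assumes H: "H \<in> L" and tr: "\<And>X. X \<in> L \<Longrightarrow> ip H X = (\<Sum>e\<in>E. ip (br X e) e)"
  shows "mean_curvature_vector L br ip = H"
  unfolding mean_curvature_vector_def
proof (rule the_equality)
  have tr': "trace_on L (br X) = ip H X" if "X \<in> L" for X
    using trace_on_frame[OF linear_br[OF that]] tr[OF that] by simp
  show "H \<in> L \<and> (\<forall>X\<in>L. ip H X = trace_on L (br X))" using H tr' by simp
  fix K assume K: "K \<in> L \<and> (\<forall>X\<in>L. ip K X = trace_on L (br X))"
  then have "ip (K - H) X = 0" if "X \<in> L" for X
    using that H by (simp add: ip_diff_left tr')
  moreover have "K - H \<in> L" using add_in[of K "- H"] minus_in H K by simp
  ultimately show "K = H" using ip_pos[of "K - H"] by fastforce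
qed

lemma ricci_quadratic:
  assumes H: "H \<in> L" and tr: "\<And>X. X \<in> L \<Longrightarrow> ip H X = (\<Sum>e\<in>E. ip (br X e) e)"
    and X: "X \<in> L"
  shows "ip (ricci_op L br ip X) X =
      - (1 / 2) * (\<Sum>e\<in>E. ip (br X e) (br X e))
      + (1 / 4) * (\<Sum>e\<in>E. \<Sum>f\<in>E. (ip (br e f) X)\<^sup>2)
      - (1 / 2) * (\<Sum>e\<in>E. ip (br X (br X e)) e) - ip (br H X) X"
proof -
  have *: "(\<Sum>e\<in>E. \<Sum>f\<in>E. (ip (br X e) f)\<^sup>2) = (\<Sum>e\<in>E. ip (br X e) (br X e))"
    using X by (intro sum.cong refl parseval_square) (simp add: br_in frame_in)
  have HX: "ip (sym_part_on L ip (br H) X) X = ip (br H X) X"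
    by (rule sym_part_quadratic[OF linear_br[OF H] X])
  have S: "sym_part_on L ip (br H) X \<in> L"
  proof -
    have ex: "\<exists>A'. linear_op_on L A' \<and> (\<forall>X\<in>L. \<forall>Y\<in>L. ip (A' X) Y = ip X (br H Y))"
      by (rule operator_of_bilinear_form[of "\<lambda>X Y. ip X (br H Y)"])
       (auto simp: ip_add_left ip_scaleR_left ip_add_right ip_scaleR_right br_in H
          br_add_right br_scaleR_right)
    have "linear_op_on L (adjoint_on L ip (br H))"
      unfolding adjoint_on_def using someI_ex[OF ex] by blast
    then show ?thesis
      unfolding sym_part_on_def linear_op_on_def using X H by (simp add: scaleR_in add_in br_in)
  qed
  have D: "X - Y \<in> L" if "X \<in> L" "Y \<in> L" for X Y
    using that add_in[of X "- Y"] minus_in by simp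
  have mc: "mean_curvature_vector L br ip = H"
    using H tr by (rule mean_curvature_eqI)
  show ?thesis
    unfolding ricci_op_def mc
    using X S
    by (simp add: ip_diff_left ip_scaleR_left moment_quadratic killing_quadratic scaleR_in D HX *)
qed

end

section \<open>Extensions by a scalar derivation\<close>

text \<open>
  The algebra \<open>(\<real>Z \<oplus> \<uu>) \<ltimes> V\<close> with \<open>Z\<close> acting as the identity on \<open>V\<close>, where \<open>\<uu>\<close> carries an
  \<open>ad\<close>-invariant inner product. The inner product of \<open>V\<close> is not tied to \<open>\<rho>\<close>:
  the negative curvature in the directions of \<open>\<uu>\<close> comes from \<open>\<rho>\<close> failing to be skew.
\<close>

locale scalar_extension =
  U: metric_lie_algebra \<uu> ipU EU brU + V: orthonormal_frame V ipV EV
  for \<uu> :: "'u::real_vector set" and ipU EU brU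
    and V :: "'v::real_vector set" and ipV EV +
  fixes \<rho> :: "'u \<Rightarrow> 'v \<Rightarrow> 'v"
  assumes V_nontrivial: "EV \<noteq> {}"
    and linear_rho: "X \<in> \<uu> \<Longrightarrow> linear_op_on V (\<rho> X)"
    and rho_add_left: "X \<in> \<uu> \<Longrightarrow> Y \<in> \<uu> \<Longrightarrow> P \<in> V \<Longrightarrow> \<rho> (X + Y) P = \<rho> X P + \<rho> Y P"
    and rho_scaleR_left: "X \<in> \<uu> \<Longrightarrow> P \<in> V \<Longrightarrow> \<rho> (c *\<^sub>R X) P = c *\<^sub>R \<rho> X P"
    and rho_br: "X \<in> \<uu> \<Longrightarrow> Y \<in> \<uu> \<Longrightarrow> P \<in> V \<Longrightarrow>
      \<rho> (brU X Y) P = \<rho> X (\<rho> Y P) - \<rho> Y (\<rho> X P)"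
    and traceless: "X \<in> \<uu> \<Longrightarrow> (\<Sum>v\<in>EV. ipV (\<rho> X v) v) = 0"
    and invariant: "X \<in> \<uu> \<Longrightarrow> Y \<in> \<uu> \<Longrightarrow> W \<in> \<uu> \<Longrightarrow> ipU (brU X Y) W = ipU X (brU Y W)"
begin

lemma rho_in: "X \<in> \<uu> \<Longrightarrow> P \<in> V \<Longrightarrow> \<rho> X P \<in> V"
  and rho_add_right: "X \<in> \<uu> \<Longrightarrow> P \<in> V \<Longrightarrow> Q \<in> V \<Longrightarrow> \<rho> X (P + Q) = \<rho> X P + \<rho> X Q"
  and rho_scaleR_right: "X \<in> \<uu> \<Longrightarrow> P \<in> V \<Longrightarrow> \<rho> X (c *\<^sub>R P) = c *\<^sub>R \<rho> X P"
  using linear_rho unfolding linear_op_on_def by simp_all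

lemma rho_zero_left: "P \<in> V \<Longrightarrow> \<rho> 0 P = 0"
  using rho_scaleR_left[of 0 P 0] U.zero_in by simp

lemma rho_zero_right: "X \<in> \<uu> \<Longrightarrow> \<rho> X 0 = 0"
  using rho_scaleR_right[of X 0 0] V.zero_in by simp

lemma rho_minus_right: "X \<in> \<uu> \<Longrightarrow> P \<in> V \<Longrightarrow> \<rho> X (- P) = - \<rho> X P"
  using rho_scaleR_right[of X P "-1"] by simp

lemma V_diff_in: "P \<in> V \<Longrightarrow> Q \<in> V \<Longrightarrow> P - Q \<in> V"
  using V.add_in[of P "- Q"] V.minus_in by simp

lemma rho_diff_right: "X \<in> \<uu> \<Longrightarrow> P \<in> V \<Longrightarrow> Q \<in> V \<Longrightarrow> \<rho> X (P - Q) = \<rho> X P - \<rho> X Q"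
  using rho_add_right[of X P "- Q"] rho_minus_right V.minus_in by simp

lemma brU_self: "X \<in> \<uu> \<Longrightarrow> brU X X = 0"
  using U.lie_algebra unfolding lie_algebra_on_def by simp

lemma jacobiU: "X \<in> \<uu> \<Longrightarrow> Y \<in> \<uu> \<Longrightarrow> W \<in> \<uu> \<Longrightarrow>
    brU X (brU Y W) + brU Y (brU W X) + brU W (brU X Y) = 0"
  using U.lie_algebra unfolding lie_algebra_on_def by simp

lemma brU_skew:
  assumes "X \<in> \<uu>" "Y \<in> \<uu>"
  shows "brU Y X = - brU X Y"
proof -
  have "brU (X + Y) (X + Y) = brU X X + brU Y X + (brU X Y + brU Y Y)"
    using assms by (simp only: U.br_add_left U.br_add_right U.add_in)
  then have "brU X Y + brU Y X = 0"
    using assms by (simp add: brU_self U.add_in add.commute)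
  then show ?thesis by (simp add: add_eq_0_iff)
qed

lemma brU_zero_left: "X \<in> \<uu> \<Longrightarrow> brU 0 X = 0"
  using U.br_scaleR_left[of 0 X 0] U.zero_in by simp

lemma brU_zero_right: "X \<in> \<uu> \<Longrightarrow> brU X 0 = 0"
  using U.br_scaleR_right[of X 0 0] U.zero_in by simp

definition L :: "(real \<times> 'u \<times> 'v) set" where
  "L = UNIV \<times> \<uu> \<times> V"

definition br :: "real \<times> 'u \<times> 'v \<Rightarrow> real \<times> 'u \<times> 'v \<Rightarrow> real \<times> 'u \<times> 'v" where
  "br x y = (case x of (a, X, P) \<Rightarrow> case y of (b, Y, Q) \<Rightarrow>
     (0, brU X Y, (a *\<^sub>R Q + \<rho> X Q) - (b *\<^sub>R P + \<rho> Y P)))"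

definition ip :: "real \<Rightarrow> real \<times> 'u \<times> 'v \<Rightarrow> real \<times> 'u \<times> 'v \<Rightarrow> real" where
  "ip \<epsilon> x y = (case x of (a, X, P) \<Rightarrow> case y of (b, Y, Q) \<Rightarrow>
     \<epsilon>\<^sup>2 * a * b + ipU X Y + ipV P Q)"

definition frame :: "real \<Rightarrow> (real \<times> 'u \<times> 'v) set" where
  "frame \<epsilon> = {(1 / \<epsilon>, 0, 0)} \<union> (\<lambda>e. (0, e, 0)) ` EU \<union> (\<lambda>v. (0, 0, v)) ` EV"

lemma L_iff: "(a, X, P) \<in> L \<longleftrightarrow> X \<in> \<uu> \<and> P \<in> V"
  by (simp add: L_def)

lemma br_triple: "br (a, X, P) (b, Y, Q) =
    (0, brU X Y, (a *\<^sub>R Q + \<rho> X Q) - (b *\<^sub>R P + \<rho> Y P))"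
  by (simp add: br_def)

lemma ip_triple: "ip \<epsilon> (a, X, P) (b, Y, Q) = \<epsilon>\<^sup>2 * a * b + ipU X Y + ipV P Q"
  by (simp add: ip_def)

lemma frame_nonzero: "0 \<notin> EU" "0 \<notin> EV"
  using U.ip_frame[of 0 0] V.ip_frame[of 0 0] U.ip_zero_left[of 0] V.ip_zero_left[of 0]
    U.zero_in V.zero_in by auto

lemma finite_frame: "finite (frame \<epsilon>)"
  by (simp add: frame_def U.finite_frame V.finite_frame)

lemma sum_frame:
  assumes "\<epsilon> > 0"
  shows "(\<Sum>x\<in>frame \<epsilon>. g x) =
    g (1 / \<epsilon>, 0, 0) + (\<Sum>e\<in>EU. g (0, e, 0)) + ((\<Sum>v\<in>EV. g (0, 0, v)) :: real)"
proof -
  have "(\<Sum>x\<in>frame \<epsilon>. g x) = g (1 / \<epsilon>, 0, 0)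
      + (\<Sum>x\<in>(\<lambda>e. (0, e, 0)) ` EU. g x) + (\<Sum>x\<in>(\<lambda>v. (0, 0, v)) ` EV. g x)"
    unfolding frame_def using frame_nonzero assms
    by (subst sum.union_disjoint; (auto simp: U.finite_frame V.finite_frame)?)
      (subst sum.insert; auto simp: U.finite_frame)
  also have "\<dots> = g (1 / \<epsilon>, 0, 0) + (\<Sum>e\<in>EU. g (0, e, 0)) + (\<Sum>v\<in>EV. g (0, 0, v))"
    by (simp add: sum.reindex inj_on_def)
  finally show ?thesis .
qed

lemma inner_product_ip:
  assumes "\<epsilon> > 0"
  shows "inner_product_on L (ip \<epsilon>)"
  unfolding inner_product_on_def
proof (intro conjI ballI allI impI)
  fix x y w :: "real \<times> 'u \<times> 'v" and c :: real
  obtain a X P b Y Q d W R where t: "x = (a, X, P)" "y = (b, Y, Q)" "w = (d, W, R)"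
    by (metis prod_cases3)
  assume x: "x \<in> L"
  {
    assume "y \<in> L"
    then have y: "X \<in> \<uu>" "P \<in> V" "Y \<in> \<uu>" "Q \<in> V" using x t by (auto simp: L_iff)
    show "ip \<epsilon> x y = ip \<epsilon> y x"
      using y U.ip_commute[of X Y] V.ip_commute[of P Q] by (simp add: t ip_triple)
    show "ip \<epsilon> (c *\<^sub>R x) y = c * ip \<epsilon> x y"
      using y by (simp add: t ip_triple U.ip_scaleR_left V.ip_scaleR_left algebra_simps)
    assume "w \<in> L"
    then show "ip \<epsilon> (x + y) w = ip \<epsilon> x w + ip \<epsilon> y w"
      using y by (simp add: t ip_triple U.ip_add_left V.ip_add_left algebra_simps L_iff)
  }
  assume "x \<noteq> 0"
  have XP: "X \<in> \<uu>" "P \<in> V" using x t by (auto simp: L_iff)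
  have "0 \<le> \<epsilon>\<^sup>2 * a * a" using assms by (simp add: mult.assoc)
  moreover have "0 < \<epsilon>\<^sup>2 * a * a" if "a \<noteq> 0"
    using assms that by (metis mult.assoc mult_pos_pos not_real_square_gt_zero zero_less_power)
  ultimately show "0 < ip \<epsilon> x x"
    using \<open>x \<noteq> 0\<close> XP U.ip_nonneg[of X] V.ip_nonneg[of P] U.ip_pos[of X] V.ip_pos[of P]
    unfolding t ip_triple zero_prod_def prod.inject by fastforce
qed

lemma orthonormal_frame_ip:
  assumes "\<epsilon> > 0"
  shows "orthonormal_frame L (ip \<epsilon>) (frame \<epsilon>)"
proof
  show "inner_product_on L (ip \<epsilon>)" by (rule inner_product_ip[OF assms])
  have sub: "subspace L"
    unfolding subspace_def
    by (auto simp: L_def zero_prod_def U.zero_in V.zero_in U.add_in V.add_in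
        U.scaleR_in V.scaleR_in)
  have "frame \<epsilon> \<subseteq> L"
    by (auto simp: frame_def L_def U.zero_in V.zero_in U.frame_in V.frame_in)
  then have "span (frame \<epsilon>) \<subseteq> L" using sub by (rule span_minimal)
  moreover have "L \<subseteq> span (frame \<epsilon>)"
  proof
    fix x assume "x \<in> L"
    then obtain a X P where x: "x = (a, X, P)" "X \<in> \<uu>" "P \<in> V" by (auto simp: L_def)
    have "(a, X, P) = (a * \<epsilon>) *\<^sub>R (1 / \<epsilon>, 0, 0) + (\<Sum>e\<in>EU. ipU X e *\<^sub>R (0, e, 0))
        + (\<Sum>v\<in>EV. ipV P v *\<^sub>R (0, 0, v))"
      using assms
      by (simp add: prod_eq_iff fst_sum snd_sum U.frame_expansion[OF x(2), symmetric]
          V.frame_expansion[OF x(3), symmetric])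
    also have "\<dots> \<in> span (frame \<epsilon>)"
      by (intro span_add span_sum span_scale span_base) (auto simp: frame_def)
    finally show "x \<in> span (frame \<epsilon>)" using x by simp
  qed
  ultimately have "span (frame \<epsilon>) = L" by (rule subset_antisym)
  moreover have "ip \<epsilon> x y = (if x = y then 1 else 0)" if "x \<in> frame \<epsilon>" "y \<in> frame \<epsilon>" for x y
    using that assms frame_nonzero unfolding frame_def
    by (auto simp: ip_triple U.ip_frame V.ip_frame power2_eq_square
        U.ip_zero_left U.ip_zero_right V.ip_zero_left V.ip_zero_right
        U.frame_in V.frame_in U.zero_in V.zero_in split: if_splits)
  ultimately show "orthonormal_basis_on L (ip \<epsilon>) (frame \<epsilon>)"
    unfolding orthonormal_basis_on_def using finite_frame by blast
qed

lemma lie_algebra_L: "lie_algebra_on L br"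
proof -
  interpret one: orthonormal_frame L "ip 1" "frame 1"
    by (rule orthonormal_frame_ip) simp
  have "\<exists>B. finite B \<and> span B = L"
    using one.finite_frame one.span_frame by blast
  moreover have "linear_op_on L (br x)" if "x \<in> L" for x
    using that unfolding linear_op_on_def
    by (auto simp: L_def br_triple U.br_in U.br_add_right U.br_scaleR_right rho_in V.add_in
        V.scaleR_in V_diff_in rho_add_left rho_add_right rho_scaleR_left rho_scaleR_right
        algebra_simps)
  moreover have "linear_op_on L (\<lambda>x. br x y)" if "y \<in> L" for y
    using that unfolding linear_op_on_def
    by (auto simp: L_def br_triple U.br_in U.br_add_left U.br_scaleR_left rho_in V.add_in
        V.scaleR_in V_diff_in rho_add_left rho_add_right rho_scaleR_left rho_scaleR_right
        algebra_simps)
  moreover have "br x x = 0" if "x \<in> L" for x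
    using that by (auto simp: L_def br_triple brU_self zero_prod_def)
  moreover have "br x (br y w) + br y (br w x) + br w (br x y) = 0"
    if "x \<in> L" "y \<in> L" "w \<in> L" for x y w
    using that
    by (auto simp: L_def br_triple jacobiU[unfolded add.assoc] zero_prod_def rho_br rho_in V.add_in
        V.scaleR_in V_diff_in U.br_in rho_diff_right rho_add_right rho_scaleR_right algebra_simps)
  ultimately show ?thesis unfolding lie_algebra_on_def by blast
qed

text \<open>
  There are no mixed terms: a bracket of two frame vectors from \<open>\<real>Z \<oplus> \<uu>\<close> lies in \<open>\<uu>\<close> and a bracket
  involving \<open>V\<close> lies in \<open>V\<close>, and the terms linear in \<open>a\<close> carry the factor \<open>tr \<rho>(X) = 0\<close>. The
  contributions of \<open>Z\<close> to the moment operator on \<open>V\<close> cancel, and invariance expresses all three sums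
  over \<open>\<uu>\<close> (in \<open>square\<close>, \<open>dual\<close> and \<open>killing\<close> below) by \<open>\<Sum>\<^sub>e |[X, e]|\<^sup>2\<close>, which occurs with the total
  factor \<open>- 1/2 + 1/4 + 1/2 = 1/4\<close>.
\<close>

lemma ricci_ip:
  fixes a :: real
  assumes \<epsilon>: "\<epsilon> > 0" and X: "X \<in> \<uu>" and P: "P \<in> V"
  shows "ip \<epsilon> (ricci_op L br (ip \<epsilon>) (a, X, P)) (a, X, P) =
    - (a\<^sup>2 * card EV)
    + (1 / 4) * (\<Sum>e\<in>EU. ipU (brU X e) (brU X e))
    - (1 / 2) * ((\<Sum>v\<in>EV. ipV (\<rho> X (\<rho> X v)) v) + (\<Sum>v\<in>EV. ipV (\<rho> X v) (\<rho> X v)))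
    - (1 / 2) * (\<Sum>e\<in>EU. ipV (\<rho> e P) (\<rho> e P))
    + (1 / 2) * (\<Sum>e\<in>EU. \<Sum>v\<in>EV. (ipV (\<rho> e v) P)\<^sup>2)
    - card EV / \<epsilon>\<^sup>2 * ipV P P"
proof -
  interpret F: orthonormal_frame L "ip \<epsilon>" "frame \<epsilon>"
    by (rule orthonormal_frame_ip[OF \<epsilon>])
  interpret F: metric_lie_algebra L "ip \<epsilon>" "frame \<epsilon>" br
    by unfold_locales (rule lie_algebra_L)
  define d where "d = real (card EV)"
  let ?H = "(d / \<epsilon>\<^sup>2, 0, 0) :: real \<times> 'u \<times> 'v" and ?x = "(a, X, P)"
  note mem = U.zero_in V.zero_in U.frame_in V.frame_in U.br_in rho_in U.add_in V.add_in
    U.scaleR_in V.scaleR_in V_diff_in V.minus_in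
  note bil = U.ip_zero_left U.ip_zero_right V.ip_zero_left V.ip_zero_right
    V.ip_add_left V.ip_add_right V.ip_scaleR_left V.ip_scaleR_right V.ip_minus_left V.ip_minus_right
    brU_zero_left brU_zero_right rho_zero_left rho_zero_right rho_minus_right
    rho_add_right rho_scaleR_right
  have unit: "ipV v v = 1" if "v \<in> EV" for v using V.ip_frame that by simp
  have skew: "ipU (brU Y e) e = 0" if "Y \<in> \<uu>" "e \<in> EU" for Y e
    using invariant[of Y e e] that by (simp add: mem brU_self U.ip_zero_right)
  have H: "?H \<in> L" by (simp add: L_iff mem)
  have tr: "ip \<epsilon> ?H x = (\<Sum>f\<in>frame \<epsilon>. ip \<epsilon> (br x f) f)" if "x \<in> L" for x
  proof -
    from that obtain b Y Q where x: "x = (b, Y, Q)" "Y \<in> \<uu>" "Q \<in> V" by (cases x) (auto simp: L_iff)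
    show ?thesis
      using \<epsilon> x(2,3) traceless[of Y]
      by (simp add: x(1) sum_frame br_triple ip_triple mem bil skew unit sum.distrib d_def)
  qed
  have square: "(\<Sum>f\<in>frame \<epsilon>. ip \<epsilon> (br ?x f) (br ?x f)) =
      ipV P P / \<epsilon>\<^sup>2 + (\<Sum>e\<in>EU. ipU (brU X e) (brU X e)) + (\<Sum>e\<in>EU. ipV (\<rho> e P) (\<rho> e P))
      + a\<^sup>2 * d + (\<Sum>v\<in>EV. ipV (\<rho> X v) (\<rho> X v))"
  proof -
    have "(\<Sum>v\<in>EV. ipV v (\<rho> X v)) = 0"
      using traceless[OF X] V.ip_commute by (simp add: mem X)
    then show ?thesis
      using \<epsilon> X P traceless[OF X]
      by (simp add: sum_frame br_triple ip_triple mem bil unit sum.distrib d_def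
          power2_eq_square sum_distrib_left[symmetric] algebra_simps)
  qed
  have dual: "(\<Sum>e\<in>frame \<epsilon>. \<Sum>f\<in>frame \<epsilon>. (ip \<epsilon> (br e f) ?x)\<^sup>2) =
      2 * (ipV P P / \<epsilon>\<^sup>2) + (\<Sum>e\<in>EU. ipU (brU X e) (brU X e))
      + 2 * (\<Sum>e\<in>EU. \<Sum>v\<in>EV. (ipV (\<rho> e v) P)\<^sup>2)"
  proof -
    have Zv: "(\<Sum>v\<in>EV. (ipV v P)\<^sup>2) = ipV P P"
      using V.parseval_square[OF P] V.ip_commute P by (simp add: mem)
    have "(\<Sum>e\<in>EU. \<Sum>f\<in>EU. (ipU (brU e f) X)\<^sup>2) = (\<Sum>e\<in>EU. \<Sum>f\<in>EU. (ipU (brU X e) f)\<^sup>2)"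
    proof (intro sum.cong refl)
      fix e f assume "e \<in> EU" "f \<in> EU"
      then show "(ipU (brU e f) X)\<^sup>2 = (ipU (brU X e) f)\<^sup>2"
        using invariant[of X e f] X U.ip_commute[of X "brU e f"] by (simp add: mem)
    qed
    also have "\<dots> = (\<Sum>e\<in>EU. ipU (brU X e) (brU X e))"
      by (intro sum.cong refl U.parseval_square) (simp add: mem X)
    finally have uu: "(\<Sum>e\<in>EU. \<Sum>f\<in>EU. (ipU (brU e f) X)\<^sup>2) = (\<Sum>e\<in>EU. ipU (brU X e) (brU X e))" .
    have vu: "(\<Sum>v\<in>EV. \<Sum>e\<in>EU. (ipV (\<rho> e v) P)\<^sup>2) = (\<Sum>e\<in>EU. \<Sum>v\<in>EV. (ipV (\<rho> e v) P)\<^sup>2)"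
      by (rule sum.swap)
    have *: "(\<Sum>v\<in>EV. (ipV v P / \<epsilon>)\<^sup>2) = ipV P P / \<epsilon>\<^sup>2"
      by (simp add: power_divide sum_divide_distrib[symmetric] Zv)
    show ?thesis
      using \<epsilon> X P uu vu *
      by (simp add: sum_frame br_triple ip_triple mem bil sum.distrib power_mult_distrib)
  qed
  have killing: "(\<Sum>f\<in>frame \<epsilon>. ip \<epsilon> (br ?x (br ?x f)) f) =
      - (\<Sum>e\<in>EU. ipU (brU X e) (brU X e)) + a\<^sup>2 * d + (\<Sum>v\<in>EV. ipV (\<rho> X (\<rho> X v)) v)"
  proof -
    have "ipU (brU X (brU X e)) e = - ipU (brU X e) (brU X e)" if e: "e \<in> EU" for e
    proof -
      have "ipU (brU X (brU X e)) e = ipU (- brU (brU X e) X) e"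
        using brU_skew[of "brU X e" X] X e by (simp add: mem)
      also have "\<dots> = - ipU (brU X e) (brU X e)"
        using invariant[of "brU X e" X e] X e by (simp add: mem U.ip_minus_left)
      finally show ?thesis .
    qed
    then show ?thesis
      using \<epsilon> X P traceless[OF X]
      by (simp add: sum_frame br_triple ip_triple mem bil unit sum.distrib sum_negf d_def
          power2_eq_square sum_distrib_left[symmetric] algebra_simps)
  qed
  have ric: "ip \<epsilon> (ricci_op L br (ip \<epsilon>) ?x) ?x =
      - (1 / 2) * (\<Sum>e\<in>frame \<epsilon>. ip \<epsilon> (br ?x e) (br ?x e))
      + (1 / 4) * (\<Sum>e\<in>frame \<epsilon>. \<Sum>f\<in>frame \<epsilon>. (ip \<epsilon> (br e f) ?x)\<^sup>2)
      - (1 / 2) * (\<Sum>e\<in>frame \<epsilon>. ip \<epsilon> (br ?x (br ?x e)) e) - ip \<epsilon> (br ?H ?x) ?x"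
    using X P by (intro F.ricci_quadratic H tr) (simp_all add: L_iff)
  have "ip \<epsilon> (br ?H ?x) ?x = d / \<epsilon>\<^sup>2 * ipV P P"
    using X P by (simp add: br_triple ip_triple mem bil)
  then show ?thesis
    unfolding ric square dual killing d_def by argo
qed

text \<open>
  The assumption makes the Ricci form negative on \<open>\<uu>\<close>. On \<open>V\<close> the only positive contribution is at most
  \<open>C/2 |P|\<^sup>2\<close> by the Cauchy-Schwarz inequality, with \<open>C\<close> independent of \<open>\<epsilon>\<close>, and shrinking \<open>Z\<close> to
  \<open>\<epsilon>\<^sup>2 = 1 / (1 + C)\<close> lets the term from \<open>H\<close> outweigh it.
\<close>

theorem admits_negative_ricci:
  assumes dominated: "\<And>X. X \<in> \<uu> \<Longrightarrow> X \<noteq> 0 \<Longrightarrow>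
    (1 / 2) * (\<Sum>e\<in>EU. ipU (brU X e) (brU X e)) <
    (\<Sum>v\<in>EV. ipV (\<rho> X (\<rho> X v)) v) + (\<Sum>v\<in>EV. ipV (\<rho> X v) (\<rho> X v))"
  shows "admits_negative_ricci L br"
proof -
  define C where "C = (\<Sum>e\<in>EU. \<Sum>v\<in>EV. ipV (\<rho> e v) (\<rho> e v))"
  have C: "C \<ge> 0"
    unfolding C_def by (intro sum_nonneg V.ip_nonneg rho_in U.frame_in V.frame_in)
  define \<epsilon> where "\<epsilon> = 1 / sqrt (1 + C)"
  have \<epsilon>: "\<epsilon> > 0" and \<epsilon>2: "1 / \<epsilon>\<^sup>2 = 1 + C"
    using C by (simp_all add: \<epsilon>_def power_divide)
  have d: "real (card EV) \<ge> 1"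
    using V_nontrivial V.finite_frame by (simp add: Suc_le_eq card_gt_0_iff)
  have "ip \<epsilon> (ricci_op L br (ip \<epsilon>) x) x < 0" if x: "x \<in> L" "x \<noteq> 0" for x
  proof -
    obtain a X P where t: "x = (a, X, P)" "X \<in> \<uu>" "P \<in> V" using x(1) by (cases x) (auto simp: L_iff)
    let ?A = "a\<^sup>2 * real (card EV)"
    let ?B = "(1 / 4) * (\<Sum>e\<in>EU. ipU (brU X e) (brU X e))
      - (1 / 2) * ((\<Sum>v\<in>EV. ipV (\<rho> X (\<rho> X v)) v) + (\<Sum>v\<in>EV. ipV (\<rho> X v) (\<rho> X v)))"
    have A: "?A \<ge> 0" "a \<noteq> 0 \<Longrightarrow> ?A > 0" using d by simp_all
    have B: "X \<noteq> 0 \<Longrightarrow> ?B < 0" using dominated[OF t(2)] by simp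
    have B0: "X = 0 \<Longrightarrow> ?B = 0"
      by (simp add: brU_zero_left U.frame_in rho_zero_left V.frame_in rho_in U.zero_in
          U.ip_zero_left V.ip_zero_left V.zero_in)
    have "(\<Sum>e\<in>EU. \<Sum>v\<in>EV. (ipV (\<rho> e v) P)\<^sup>2)
        \<le> (\<Sum>e\<in>EU. \<Sum>v\<in>EV. ipV (\<rho> e v) (\<rho> e v) * ipV P P)"
      by (intro sum_mono V.cauchy_schwarz rho_in U.frame_in V.frame_in t)
    also have "\<dots> = C * ipV P P" by (simp add: C_def sum_distrib_right)
    finally have D: "(\<Sum>e\<in>EU. \<Sum>v\<in>EV. (ipV (\<rho> e v) P)\<^sup>2) \<le> C * ipV P P" .
    have P0: "ipV P P \<ge> 0" "P \<noteq> 0 \<Longrightarrow> ipV P P > 0"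
      using V.ip_nonneg V.ip_pos t by auto
    have "(1 + C) * ipV P P \<le> real (card EV) * ((1 + C) * ipV P P)"
      using mult_right_mono[OF d, of "(1 + C) * ipV P P"] C P0 by simp
    also have "\<dots> = card EV / \<epsilon>\<^sup>2 * ipV P P"
      using \<epsilon>2 by (simp add: divide_inverse)
    finally have F: "ipV P P + C * ipV P P \<le> card EV / \<epsilon>\<^sup>2 * ipV P P"
      by (simp add: algebra_simps)
    have G: "(\<Sum>e\<in>EU. ipV (\<rho> e P) (\<rho> e P)) \<ge> 0"
      by (intro sum_nonneg V.ip_nonneg rho_in U.frame_in t)
    have CP: "C * ipV P P \<ge> 0" using C P0 by simp
    have "ip \<epsilon> (ricci_op L br (ip \<epsilon>) x) x \<le> - ?A + ?B - ipV P P"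
      using ricci_ip[OF \<epsilon> t(2,3), of a] D F G CP unfolding t(1) by linarith
    moreover have "a \<noteq> 0 \<or> X \<noteq> 0 \<or> P \<noteq> 0" using x(2) t(1) by (auto simp: zero_prod_def)
    moreover have "?B \<le> 0" using B B0 by (cases "X = 0") (simp_all only: le_less simp_thms)
    ultimately show ?thesis
      using A B P0 by (smt (verit, best))
  qed
  then show ?thesis
    unfolding admits_negative_ricci_def negative_ricci_def
    using lie_algebra_L inner_product_ip[OF \<epsilon>] by blast
qed

end

section \<open>The standard representation acts by derivations\<close>

text \<open>
  The exponential is handled entrywise: each entry of \<open>mexp (c *\<^sub>R X)\<close> is a scalar power series in
  \<open>c\<close> with infinite radius of convergence, and may therefore be differentiated term by term. Only its
  value and its derivative at 0 matter.
\<close>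

lemma matpow_entry_bound:
  fixes X :: "complex^'r::finite^'r"
  shows "norm (((**) X ^^ k) (mat 1) $ i $ j) \<le> (\<Sum>a\<in>UNIV. \<Sum>b\<in>UNIV. norm (X $ a $ b)) ^ k"
proof (induction k arbitrary: i)
  case 0
  show ?case by (simp add: mat_def)
next
  case (Suc k)
  let ?C = "\<Sum>a\<in>UNIV. \<Sum>b\<in>UNIV. norm (X $ a $ b)"
  have C: "?C \<ge> 0" by (intro sum_nonneg) simp
  have "norm (((**) X ^^ Suc k) (mat 1) $ i $ j)
      \<le> (\<Sum>l\<in>UNIV. norm (X $ i $ l * ((**) X ^^ k) (mat 1) $ l $ j))"
    by (simp add: matrix_matrix_mult_def norm_sum)
  also have "\<dots> \<le> (\<Sum>l\<in>UNIV. norm (X $ i $ l) * ?C ^ k)"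
    by (intro sum_mono) (auto simp: norm_mult intro!: mult_left_mono Suc.IH)
  also have "\<dots> = (\<Sum>l\<in>UNIV. norm (X $ i $ l)) * ?C ^ k" by (simp add: sum_distrib_right)
  also have "\<dots> \<le> ?C * ?C ^ k"
    using C by (intro mult_right_mono member_le_sum[of i UNIV "\<lambda>a. \<Sum>b\<in>UNIV. norm (X $ a $ b)"])
      (auto intro: sum_nonneg)
  finally show ?case by simp
qed

lemma matpow_scaleR:
  fixes X :: "complex^'r::finite^'r"
  shows "((**) (c *\<^sub>R X) ^^ k) (mat 1) = c ^ k *\<^sub>R ((**) X ^^ k) (mat 1)"
proof (induction k)
  case (Suc k)
  have "((**) (c *\<^sub>R X) ^^ Suc k) (mat 1) = (c *\<^sub>R X) ** (c ^ k *\<^sub>R ((**) X ^^ k) (mat 1))"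
    by (simp add: Suc)
  also have "\<dots> = c ^ Suc k *\<^sub>R ((**) X ^^ Suc k) (mat 1)"
    by (simp add: vec_eq_iff matrix_matrix_mult_def scaleR_sum_right mult.commute[of c])
  finally show ?case .
qed simp

lemma mexp_power_series_summable:
  fixes X :: "complex^'r::finite^'r"
  shows "summable (\<lambda>k. ((**) X ^^ k) (mat 1) $ i $ j / fact k * \<zeta> ^ k)"
proof (rule summable_comparison_test)
  let ?C = "\<Sum>a\<in>UNIV. \<Sum>b\<in>UNIV. norm (X $ a $ b)"
  have "norm (((**) X ^^ k) (mat 1) $ i $ j / fact k * \<zeta> ^ k) \<le> inverse (fact k) * (?C * norm \<zeta>) ^ k"
    for k
  proof -
    have "norm (((**) X ^^ k) (mat 1) $ i $ j / fact k * \<zeta> ^ k)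
        = norm (((**) X ^^ k) (mat 1) $ i $ j) * (inverse (fact k) * norm \<zeta> ^ k)"
      by (simp add: norm_mult norm_divide norm_power divide_inverse norm_inverse)
    also have "\<dots> \<le> ?C ^ k * (inverse (fact k) * norm \<zeta> ^ k)"
      by (intro mult_right_mono matpow_entry_bound) simp
    finally show ?thesis by (simp add: power_mult_distrib ac_simps)
  qed
  then show "\<exists>N. \<forall>k\<ge>N. norm (((**) X ^^ k) (mat 1) $ i $ j / fact k * \<zeta> ^ k)
      \<le> inverse (fact k) * (?C * norm \<zeta>) ^ k" by blast
  show "summable (\<lambda>k. inverse (fact k) * (?C * norm \<zeta>) ^ k)" by (rule summable_exp)
qed

lemma mexp_scaleR_entry:
  fixes X :: "complex^'r::finite^'r"
  shows "mexp (c *\<^sub>R X) $ i $ j =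
    (\<Sum>k. ((**) X ^^ k) (mat 1) $ i $ j / fact k * of_real c ^ k)"
proof -
  let ?f = "\<lambda>k. (1 / fact k) *\<^sub>R ((**) (c *\<^sub>R X) ^^ k) (mat 1) :: complex^'r^'r"
  have entry: "?f k $ i $ j = ((**) X ^^ k) (mat 1) $ i $ j / fact k * of_real c ^ k" for k i j
    by (simp add: matpow_scaleR scaleR_conv_of_real[where 'a = complex] divide_inverse)
  have "?f sums (\<chi> i j. \<Sum>k. ((**) X ^^ k) (mat 1) $ i $ j / fact k * of_real c ^ k)"
    unfolding sums_def
  proof (intro vec_tendstoI)
    fix i j
    have "(\<lambda>n. \<Sum>k<n. ?f k $ i $ j) \<longlonglongrightarrow>
        (\<Sum>k. ((**) X ^^ k) (mat 1) $ i $ j / fact k * of_real c ^ k)"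
      using summable_sums[OF mexp_power_series_summable[of X i j "of_real c"]]
      unfolding entry sums_def .
    then show "(\<lambda>n. sum ?f {..<n} $ i $ j) \<longlonglongrightarrow>
        (\<chi> i j. \<Sum>k. ((**) X ^^ k) (mat 1) $ i $ j / fact k * of_real c ^ k) $ i $ j"
      by simp
  qed
  from sums_unique[OF this] show ?thesis
    unfolding mexp_def by (metis (no_types, lifting) vec_lambda_beta)
qed

lemma mexp_zero: "mexp 0 = (mat 1 :: complex^'r::finite^'r)"
proof -
  have "mexp (0 *\<^sub>R (0 :: complex^'r^'r)) $ i $ j = (mat 1 :: complex^'r^'r) $ i $ j" for i j
    unfolding mexp_scaleR_entry of_real_0 powser_zero by simp
  then show ?thesis by (simp add: vec_eq_iff)
qed

lemma mexp_entry_has_vector_derivative: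
  fixes X :: "complex^'r::finite^'r"
  shows "((\<lambda>t::real. mexp ((- t) *\<^sub>R X) $ i $ j) has_vector_derivative - X $ i $ j) (at 0)"
proof -
  let ?c = "\<lambda>k. ((**) X ^^ k) (mat 1) $ i $ j / fact k"
  have "((\<lambda>\<zeta>. \<Sum>k. ?c k * \<zeta> ^ k) has_field_derivative (\<Sum>k. diffs ?c k * 0 ^ k)) (at 0)"
    by (rule termdiffs_strong_converges_everywhere) (rule mexp_power_series_summable)
  moreover have "(\<Sum>k. diffs ?c k * 0 ^ k) = X $ i $ j"
    by (subst powser_zero) (simp add: diffs_def)
  ultimately have "((\<lambda>\<zeta>. \<Sum>k. ?c k * \<zeta> ^ k) has_field_derivative X $ i $ j) (at (- (of_real 0)))"
    by simp
  then have "((\<lambda>\<zeta>. \<Sum>k. ?c k * (- \<zeta>) ^ k) has_field_derivative - X $ i $ j) (at (of_real 0))"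
    using DERIV_chain2[of "\<lambda>\<zeta>. \<Sum>k. ?c k * \<zeta> ^ k" "X $ i $ j" uminus "of_real 0" "- 1" UNIV]
    by (simp add: DERIV_minus[OF DERIV_ident])
  from has_vector_derivative_real_field[OF this, of UNIV] show ?thesis
    unfolding mexp_scaleR_entry by simp
qed

text \<open>
  On the algebra generated by the coordinates, the operator \<open>std_rep X\<close> is a derivation, and a
  derivation is determined by its values on the generators. Working on the whole algebra instead of
  a fixed degree allows every identity to be checked on generators and extended by the product rule.
\<close>

inductive polynomial_fun :: "(complex^'r::finite \<Rightarrow> complex) \<Rightarrow> bool" where
  const: "polynomial_fun (\<lambda>z. c)"
| coord: "polynomial_fun (\<lambda>z. z $ i)"
| add: "polynomial_fun P \<Longrightarrow> polynomial_fun Q \<Longrightarrow> polynomial_fun (\<lambda>z. P z + Q z)"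
| mult: "polynomial_fun P \<Longrightarrow> polynomial_fun Q \<Longrightarrow> polynomial_fun (\<lambda>z. P z * Q z)"

lemma std_rep_eqI:
  "((\<lambda>t::real. P (mexp ((- t) *\<^sub>R X) *v z)) has_vector_derivative D) (at 0) \<Longrightarrow> std_rep X P z = D"
  unfolding std_rep_def by (rule vector_derivative_at)

lemma coord_has_derivative:
  "((\<lambda>t::real. (mexp ((- t) *\<^sub>R X) *v z) $ i) has_vector_derivative - (X *v z) $ i) (at 0)"
proof -
  have "((\<lambda>t::real. \<Sum>j\<in>UNIV. mexp ((- t) *\<^sub>R X) $ i $ j * z $ j) has_vector_derivative
      (\<Sum>j\<in>UNIV. - X $ i $ j * z $ j)) (at 0)"
    by (intro has_vector_derivative_sum has_vector_derivative_mult_left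
        mexp_entry_has_vector_derivative)
  then show ?thesis by (simp add: matrix_vector_mult_def sum_negf)
qed

lemma polynomial_fun_has_derivative:
  assumes "polynomial_fun P"
  shows "((\<lambda>t::real. P (mexp ((- t) *\<^sub>R X) *v z)) has_vector_derivative std_rep X P z) (at 0)"
proof -
  have "\<exists>D. ((\<lambda>t::real. P (mexp ((- t) *\<^sub>R X) *v z)) has_vector_derivative D) (at 0)"
    using assms
  proof induction
    case (const c)
    show ?case using has_vector_derivative_const by blast
  next
    case (coord i)
    show ?case using coord_has_derivative by blast
  next
    case (add P Q)
    then show ?case using has_vector_derivative_add by blast
  next
    case (mult P Q)
    then show ?case using has_vector_derivative_mult by blast
  qed
  then show ?thesis using std_rep_eqI by metis
qed

lemma std_rep_const: "std_rep X (\<lambda>z. c) = (\<lambda>z. 0)"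
  by (intro ext std_rep_eqI) simp

lemma std_rep_coord: "std_rep X (\<lambda>z. z $ i) = (\<lambda>z. - (X *v z) $ i)"
  by (intro ext std_rep_eqI coord_has_derivative)

lemma std_rep_add:
  assumes "polynomial_fun P" "polynomial_fun Q"
  shows "std_rep X (\<lambda>z. P z + Q z) = (\<lambda>z. std_rep X P z + std_rep X Q z)"
  by (intro ext std_rep_eqI has_vector_derivative_add polynomial_fun_has_derivative assms)

lemma std_rep_mult:
  assumes "polynomial_fun P" "polynomial_fun Q"
  shows "std_rep X (\<lambda>z. P z * Q z) = (\<lambda>z. P z * std_rep X Q z + std_rep X P z * Q z)"
proof (intro ext std_rep_eqI)
  fix z
  show "((\<lambda>t::real. P (mexp ((- t) *\<^sub>R X) *v z) * Q (mexp ((- t) *\<^sub>R X) *v z))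
      has_vector_derivative P z * std_rep X Q z + std_rep X P z * Q z) (at 0)"
    using has_vector_derivative_mult[OF polynomial_fun_has_derivative[OF assms(1), of X z]
        polynomial_fun_has_derivative[OF assms(2), of X z]]
    by (simp add: mexp_zero)
qed

lemma polynomial_fun_sum:
  "(\<And>i. i \<in> I \<Longrightarrow> polynomial_fun (f i)) \<Longrightarrow> polynomial_fun (\<lambda>z. \<Sum>i\<in>I. f i z)"
  by (induction I rule: infinite_finite_induct) (auto intro: polynomial_fun.intros)

lemma polynomial_fun_prod:
  "(\<And>i. i \<in> I \<Longrightarrow> polynomial_fun (f i)) \<Longrightarrow> polynomial_fun (\<lambda>z. \<Prod>i\<in>I. f i z)"
  by (induction I rule: infinite_finite_induct) (auto intro: polynomial_fun.intros)

lemma polynomial_fun_power: "polynomial_fun P \<Longrightarrow> polynomial_fun (\<lambda>z. P z ^ k)"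
  by (induction k) (auto intro: polynomial_fun.intros)

lemma polynomial_fun_linear: "polynomial_fun (\<lambda>z. - ((X *v z) $ i))"
proof -
  have "polynomial_fun (\<lambda>z. \<Sum>j\<in>UNIV. - X $ i $ j * z $ j)"
    by (intro polynomial_fun_sum polynomial_fun.intros)
  then show ?thesis by (simp add: matrix_vector_mult_def sum_negf)
qed

lemma std_rep_cmult:
  "polynomial_fun P \<Longrightarrow> std_rep X (\<lambda>z. c * P z) = (\<lambda>z. c * std_rep X P z)"
  by (simp add: std_rep_mult polynomial_fun.const std_rep_const)

lemma std_rep_sum:
  "(\<And>i. i \<in> I \<Longrightarrow> polynomial_fun (f i)) \<Longrightarrow>
    std_rep X (\<lambda>z. \<Sum>i\<in>I. f i z) = (\<lambda>z. \<Sum>i\<in>I. std_rep X (f i) z)"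
  by (induction I rule: infinite_finite_induct)
    (simp_all add: std_rep_const std_rep_add polynomial_fun_sum)

lemma polynomial_fun_std_rep: "polynomial_fun P \<Longrightarrow> polynomial_fun (std_rep X P)"
  by (induction rule: polynomial_fun.induct)
    (auto simp: std_rep_const std_rep_coord std_rep_add std_rep_mult
      intro: polynomial_fun.intros polynomial_fun_linear)

lemma std_rep_matrix_add:
  "polynomial_fun P \<Longrightarrow> std_rep (X + Y) P = (\<lambda>z. std_rep X P z + std_rep Y P z)"
  by (induction rule: polynomial_fun.induct)
    (simp_all add: std_rep_const std_rep_coord std_rep_add std_rep_mult algebra_simps)

lemma std_rep_matrix_scaleR:
  "polynomial_fun P \<Longrightarrow> std_rep (c *\<^sub>R X) P = (\<lambda>z. c *\<^sub>R std_rep X P z)"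
proof (induction rule: polynomial_fun.induct)
  case (coord i)
  show ?case
    by (simp add: std_rep_coord matrix_vector_mult_def scaleR_sum_right)
qed (simp_all add: std_rep_const std_rep_add std_rep_mult algebra_simps)

text \<open>
  The commutator of two derivations is a derivation, so it suffices to compare both sides on the
  coordinates. The representation reverses products there, which the sign in
  \<open>std_rep X z\<^sub>i = - (X z)\<^sub>i\<close> compensates.
\<close>

lemma std_rep_commutator:
  "polynomial_fun P \<Longrightarrow>
    std_rep (X ** Y - Y ** X) P = (\<lambda>z. std_rep X (std_rep Y P) z - std_rep Y (std_rep X P) z)"
proof (induction rule: polynomial_fun.induct)
  case (const c)
  show ?case by (simp add: std_rep_const)
next
  case (coord i)
  have lin: "std_rep A (std_rep B (\<lambda>z. z $ i)) z = ((B ** A) *v z) $ i" for A B :: "complex^'a^'a" and z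
  proof -
    have "std_rep A (\<lambda>z. \<Sum>j\<in>UNIV. - B $ i $ j * z $ j) z = (\<Sum>j\<in>UNIV. - B $ i $ j * - (A *v z) $ j)"
      by (simp only: std_rep_sum std_rep_cmult std_rep_coord polynomial_fun.intros)
    also have "\<dots> = (B *v (A *v z)) $ i" by (simp add: matrix_vector_mult_def)
    also have "\<dots> = ((B ** A) *v z) $ i" by (simp add: matrix_vector_mul_assoc)
    also have "(\<lambda>z. \<Sum>j\<in>UNIV. - B $ i $ j * z $ j) = std_rep B (\<lambda>z. z $ i)"
      by (simp add: std_rep_coord matrix_vector_mult_def sum_negf)
    finally show ?thesis .
  qed
  show ?case by (simp add: lin) (simp add: std_rep_coord algebra_simps)
next
  case (add P Q)
  then show ?case by (simp add: std_rep_add polynomial_fun_std_rep algebra_simps)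
next
  case (mult P Q)
  then show ?case
    by (simp add: std_rep_add std_rep_mult polynomial_fun_std_rep polynomial_fun.mult algebra_simps)
qed

lemma std_rep_prod:
  assumes "finite I" "\<And>i. i \<in> I \<Longrightarrow> polynomial_fun (f i)"
  shows "std_rep X (\<lambda>z. \<Prod>i\<in>I. f i z) =
    (\<lambda>z. \<Sum>i\<in>I. std_rep X (f i) z * (\<Prod>j\<in>I - {i}. f j z))"
  using assms
proof (induction I rule: finite_induct)
  case empty
  show ?case by (simp add: std_rep_const)
next
  case (insert a I)
  show ?case
  proof
    fix z
    have "std_rep X (\<lambda>z. \<Prod>i\<in>insert a I. f i z) z
        = f a z * (\<Sum>i\<in>I. std_rep X (f i) z * (\<Prod>j\<in>I - {i}. f j z)) + std_rep X (f a) z * (\<Prod>i\<in>I. f i z)"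
      using insert by (simp add: std_rep_mult polynomial_fun_prod)
    also have "f a z * (\<Sum>i\<in>I. std_rep X (f i) z * (\<Prod>j\<in>I - {i}. f j z))
        = (\<Sum>i\<in>I. std_rep X (f i) z * (\<Prod>j\<in>insert a I - {i}. f j z))"
      unfolding sum_distrib_left
    proof (intro sum.cong refl)
      fix i assume i: "i \<in> I"
      then have "insert a I - {i} = insert a (I - {i})" using insert.hyps by auto
      then show "f a z * (std_rep X (f i) z * (\<Prod>j\<in>I - {i}. f j z))
          = std_rep X (f i) z * (\<Prod>j\<in>insert a I - {i}. f j z)"
        using insert.hyps by simp
    qed
    also have "(\<Prod>i\<in>I. f i z) = (\<Prod>j\<in>insert a I - {a}. f j z)"
      using insert.hyps by simp
    finally show "std_rep X (\<lambda>z. \<Prod>i\<in>insert a I. f i z) z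
        = (\<Sum>i\<in>insert a I. std_rep X (f i) z * (\<Prod>j\<in>insert a I - {i}. f j z))"
      using insert.hyps by simp
  qed
qed

lemma std_rep_power:
  "polynomial_fun P \<Longrightarrow> std_rep X (\<lambda>z. P z ^ k) = (\<lambda>z. of_nat k * P z ^ (k - 1) * std_rep X P z)"
proof (induction k)
  case 0
  show ?case by (simp add: std_rep_const)
next
  case (Suc k)
  have "std_rep X (\<lambda>z. P z ^ Suc k) = (\<lambda>z. P z * std_rep X (\<lambda>z. P z ^ k) z + std_rep X P z * P z ^ k)"
    using Suc.prems by (simp add: std_rep_mult polynomial_fun_power)
  also have "\<dots> = (\<lambda>z. of_nat (Suc k) * P z ^ (Suc k - 1) * std_rep X P z)"
    unfolding Suc.IH[OF Suc.prems] by (cases k) (simp_all add: algebra_simps)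
  finally show ?case .
qed

section \<open>Coefficients of homogeneous polynomials\<close>

definition multi_indices :: "nat \<Rightarrow> ('r::finite \<Rightarrow> nat) set" where
  "multi_indices n = {\<alpha>. (\<Sum>i\<in>UNIV. \<alpha> i) = n}"

definition monomial :: "('r::finite \<Rightarrow> nat) \<Rightarrow> complex^'r \<Rightarrow> complex" where
  "monomial \<alpha> z = (\<Prod>i\<in>UNIV. (z $ i) ^ \<alpha> i)"

lemma multi_index_le: "\<alpha> \<in> multi_indices n \<Longrightarrow> \<alpha> i \<le> n"
  using member_le_sum[of i UNIV \<alpha>] by (auto simp: multi_indices_def)

lemma finite_multi_indices: "finite (multi_indices n :: ('r::finite \<Rightarrow> nat) set)"
proof (rule finite_subset)
  show "multi_indices n \<subseteq> (\<Pi>\<^sub>E i\<in>(UNIV :: 'r set). {..n})"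
    by (auto simp: multi_index_le)
  show "finite (\<Pi>\<^sub>E i\<in>(UNIV :: 'r set). {..n})"
    by (intro finite_PiE) auto
qed

lemma homog_polys_iff:
  "P \<in> homog_polys n \<longleftrightarrow> (\<exists>c. P = (\<lambda>z. \<Sum>\<alpha>\<in>multi_indices n. c \<alpha> * monomial \<alpha> z))"
  by (simp add: homog_polys_def multi_indices_def monomial_def)

lemma homog_polysI:
  "P = (\<lambda>z. \<Sum>\<alpha>\<in>multi_indices n. c \<alpha> * monomial \<alpha> z) \<Longrightarrow> P \<in> homog_polys n"
  unfolding homog_polys_iff by (rule exI[of _ c])

text \<open>
  Uniqueness of base \<open>N\<close> expansions; it separates the exponents after the substitution in
  \<open>monomials_independent\<close>.
\<close>

lemma base_digits_unique:
  fixes f g :: "nat \<Rightarrow> nat"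
  assumes "\<forall>i<m. f i < N \<and> g i < N" and "(\<Sum>i<m. f i * N ^ i) = (\<Sum>i<m. g i * N ^ i)"
  shows "\<forall>i<m. f i = g i"
  using assms
proof (induction m arbitrary: f g)
  case (Suc m)
  have split: "(\<Sum>i<Suc m. h i * N ^ i) = h 0 + N * (\<Sum>i<m. h (Suc i) * N ^ i)" for h :: "nat \<Rightarrow> nat"
    by (simp add: sum.lessThan_Suc_shift sum_distrib_left ac_simps del: sum.lessThan_Suc)
  have lt: "f 0 < N" "g 0 < N" using Suc.prems(1) by auto
  have eq: "f 0 + N * (\<Sum>i<m. f (Suc i) * N ^ i) = g 0 + N * (\<Sum>i<m. g (Suc i) * N ^ i)"
    using Suc.prems(2) unfolding split .
  from arg_cong[OF eq, of "\<lambda>x. x mod N"] have f0: "f 0 = g 0" using lt by simp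
  with eq lt have "(\<Sum>i<m. f (Suc i) * N ^ i) = (\<Sum>i<m. g (Suc i) * N ^ i)" by simp
  then have "\<forall>i<m. f (Suc i) = g (Suc i)"
    using Suc.prems(1) by (intro Suc.IH) auto
  then show ?case using f0 by (auto simp: less_Suc_eq_0_disj)
qed simp

text \<open>
  Kronecker substitution: with \<open>N = n + 1\<close>, putting \<open>t\<close> to the power \<open>N\<^sup>k\<close> for the \<open>k\<close>-th variable sends
  distinct monomials of degree \<open>n\<close> to distinct powers of \<open>t\<close>, since their exponents are the digits of
  the resulting power. The claim reduces to polynomials in one variable.
\<close>

lemma monomials_independent:
  fixes c :: "('r::finite \<Rightarrow> nat) \<Rightarrow> complex"
  assumes zero: "\<And>z. (\<Sum>\<alpha>\<in>multi_indices n. c \<alpha> * monomial \<alpha> z) = 0"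
    and \<beta>: "\<beta> \<in> multi_indices n"
  shows "c \<beta> = 0"
proof -
  obtain idx :: "'r \<Rightarrow> nat" where idx: "bij_betw idx UNIV {..<CARD('r)}"
    using ex_bij_betw_finite_nat[of "UNIV :: 'r set"] by (auto simp: atLeast0LessThan)
  define N where "N = Suc n"
  define e where "e \<alpha> = (\<Sum>i\<in>UNIV. \<alpha> i * N ^ idx i)" for \<alpha> :: "'r \<Rightarrow> nat"
  have inj: "inj_on e (multi_indices n)"
  proof (rule inj_onI)
    fix \<alpha> \<gamma> :: "'r \<Rightarrow> nat"
    assume \<alpha>: "\<alpha> \<in> multi_indices n" and \<gamma>: "\<gamma> \<in> multi_indices n" and eq: "e \<alpha> = e \<gamma>"
    let ?j = "inv_into UNIV idx"
    have e: "e \<delta> = (\<Sum>k<CARD('r). \<delta> (?j k) * N ^ k)" for \<delta>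
      unfolding e_def using idx
      by (intro sum.reindex_bij_witness[of _ ?j idx])
        (auto simp: bij_betw_def inv_into_f_f f_inv_into_f)
    have "\<forall>k<CARD('r). \<alpha> (?j k) = \<gamma> (?j k)"
      using eq multi_index_le[OF \<alpha>] multi_index_le[OF \<gamma>] unfolding e
      by (intro base_digits_unique) (auto simp: N_def less_Suc_eq_le)
    moreover have "idx i < CARD('r)" "?j (idx i) = i" for i
      using idx by (auto simp: bij_betw_def)
    ultimately show "\<alpha> = \<gamma>" by (metis ext)
  qed
  define p where "p = (\<Sum>\<alpha>\<in>multi_indices n. monom (c \<alpha>) (e \<alpha>))"
  have "poly p t = 0" for t
  proof -
    have "monomial \<alpha> (\<chi> i. t ^ (N ^ idx i)) = t ^ e \<alpha>" for \<alpha>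
      by (simp add: monomial_def e_def power_sum power_mult[symmetric] mult.commute)
    then show ?thesis
      using zero[of "\<chi> i. t ^ (N ^ idx i)"] by (simp add: p_def poly_sum poly_monom)
  qed
  then have "p = 0" using poly_all_0_iff_0 by blast
  moreover have "coeff p (e \<beta>) = (\<Sum>\<alpha>\<in>multi_indices n. if \<alpha> = \<beta> then c \<alpha> else 0)"
    unfolding p_def coeff_sum using inj \<beta>
    by (intro sum.cong refl) (auto simp: inj_on_eq_iff)
  ultimately show ?thesis using \<beta> by (simp add: finite_multi_indices)
qed

definition mcoeff :: "nat \<Rightarrow> (complex^'r::finite \<Rightarrow> complex) \<Rightarrow> ('r \<Rightarrow> nat) \<Rightarrow> complex" where
  "mcoeff n P = (SOME c. P = (\<lambda>z. \<Sum>\<alpha>\<in>multi_indices n. c \<alpha> * monomial \<alpha> z))"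

lemma mcoeff_expansion:
  assumes "P \<in> homog_polys n"
  shows "P = (\<lambda>z. \<Sum>\<alpha>\<in>multi_indices n. mcoeff n P \<alpha> * monomial \<alpha> z)"
proof -
  have "\<exists>c. P = (\<lambda>z. \<Sum>\<alpha>\<in>multi_indices n. c \<alpha> * monomial \<alpha> z)"
    using assms unfolding homog_polys_iff .
  from someI_ex[OF this] show ?thesis unfolding mcoeff_def .
qed

lemma mcoeff_expansion_at:
  "P \<in> homog_polys n \<Longrightarrow> (\<Sum>\<alpha>\<in>multi_indices n. mcoeff n P \<alpha> * monomial \<alpha> z) = P z"
  by (rule fun_cong[OF mcoeff_expansion, symmetric])

lemma mcoeff_eqI:
  assumes P: "P = (\<lambda>z. \<Sum>\<alpha>\<in>multi_indices n. c \<alpha> * monomial \<alpha> z)" and \<beta>: "\<beta> \<in> multi_indices n"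
  shows "mcoeff n P \<beta> = c \<beta>"
proof -
  from P have "P \<in> homog_polys n" by (rule homog_polysI)
  then have "(\<Sum>\<alpha>\<in>multi_indices n. (mcoeff n P \<alpha> - c \<alpha>) * monomial \<alpha> z) = 0" for z
    using fun_cong[OF P, of z]
    by (simp add: left_diff_distrib sum_subtractf mcoeff_expansion_at)
  from monomials_independent[OF this \<beta>] show ?thesis by simp
qed

lemma
  assumes P: "P \<in> homog_polys n" and Q: "Q \<in> homog_polys n"
  shows homog_polys_add: "(\<lambda>z. P z + Q z) \<in> homog_polys n"
    and mcoeff_add: "\<beta> \<in> multi_indices n \<Longrightarrow> mcoeff n (\<lambda>z. P z + Q z) \<beta> = mcoeff n P \<beta> + mcoeff n Q \<beta>"
proof -
  have *: "(\<lambda>z. P z + Q z) = (\<lambda>z. \<Sum>\<alpha>\<in>multi_indices n. (mcoeff n P \<alpha> + mcoeff n Q \<alpha>) * monomial \<alpha> z)"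
    by (simp add: distrib_right sum.distrib mcoeff_expansion_at P Q)
  show "(\<lambda>z. P z + Q z) \<in> homog_polys n" by (rule homog_polysI[OF *])
  show "\<beta> \<in> multi_indices n \<Longrightarrow> mcoeff n (\<lambda>z. P z + Q z) \<beta> = mcoeff n P \<beta> + mcoeff n Q \<beta>"
    by (rule mcoeff_eqI[OF *])
qed

lemma
  assumes P: "P \<in> homog_polys n"
  shows homog_polys_cmult: "(\<lambda>z. c * P z) \<in> homog_polys n"
    and mcoeff_cmult: "\<beta> \<in> multi_indices n \<Longrightarrow> mcoeff n (\<lambda>z. c * P z) \<beta> = c * mcoeff n P \<beta>"
proof -
  have *: "(\<lambda>z. c * P z) = (\<lambda>z. \<Sum>\<alpha>\<in>multi_indices n. (c * mcoeff n P \<alpha>) * monomial \<alpha> z)"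
    by (simp add: sum_distrib_left[symmetric] mult.assoc mcoeff_expansion_at P)
  show "(\<lambda>z. c * P z) \<in> homog_polys n" by (rule homog_polysI[OF *])
  show "\<beta> \<in> multi_indices n \<Longrightarrow> mcoeff n (\<lambda>z. c * P z) \<beta> = c * mcoeff n P \<beta>"
    by (rule mcoeff_eqI[OF *])
qed

lemma homog_polys_sum:
  "(\<And>i. i \<in> I \<Longrightarrow> f i \<in> homog_polys n) \<Longrightarrow> (\<lambda>z. \<Sum>i\<in>I. f i z) \<in> homog_polys n"
proof (induction I rule: infinite_finite_induct)
  case empty
  show ?case by (rule homog_polysI[of _ "\<lambda>_. 0" n]) simp
next
  case (infinite A)
  show ?case by (rule homog_polysI[of _ "\<lambda>_. 0" n]) (simp add: infinite.hyps)
qed (simp add: homog_polys_add)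

lemma mcoeff_sum:
  "finite I \<Longrightarrow> (\<And>i. i \<in> I \<Longrightarrow> f i \<in> homog_polys n) \<Longrightarrow> \<beta> \<in> multi_indices n \<Longrightarrow>
    mcoeff n (\<lambda>z. \<Sum>i\<in>I. f i z) \<beta> = (\<Sum>i\<in>I. mcoeff n (f i) \<beta>)"
proof (induction I rule: finite_induct)
  case empty
  show ?case using mcoeff_eqI[of "\<lambda>z. 0" "\<lambda>_. 0" n \<beta>] empty by simp
qed (simp add: mcoeff_add homog_polys_sum)

lemma
  assumes \<alpha>: "\<alpha> \<in> multi_indices n"
  shows monomial_homog: "monomial \<alpha> \<in> homog_polys n"
    and mcoeff_monomial: "\<beta> \<in> multi_indices n \<Longrightarrow> mcoeff n (monomial \<alpha>) \<beta> = (if \<beta> = \<alpha> then 1 else 0)"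
proof -
  have *: "monomial \<alpha> = (\<lambda>z. \<Sum>\<gamma>\<in>multi_indices n. (if \<gamma> = \<alpha> then 1 else 0) * monomial \<gamma> z)"
    using \<alpha> by (simp add: finite_multi_indices if_distrib[of "\<lambda>x. x * _"] cong: if_cong)
  show "monomial \<alpha> \<in> homog_polys n" by (rule homog_polysI[OF *])
  show "\<beta> \<in> multi_indices n \<Longrightarrow> mcoeff n (monomial \<alpha>) \<beta> = (if \<beta> = \<alpha> then 1 else 0)"
    by (rule mcoeff_eqI[OF *])
qed

lemma polynomial_fun_monomial: "polynomial_fun (monomial \<alpha>)"
  unfolding monomial_def[abs_def]
  by (intro polynomial_fun_prod polynomial_fun_power polynomial_fun.coord)

lemma polynomial_fun_homog: "P \<in> homog_polys n \<Longrightarrow> polynomial_fun P"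
  unfolding homog_polys_iff
  by (auto intro!: polynomial_fun_sum polynomial_fun.mult polynomial_fun.const polynomial_fun_monomial)

text \<open>
  The exponent of \<open>z\<^sub>j \<partial>\<^sub>i z\<^sup>\<alpha>\<close>. Because of truncated subtraction it has the wrong degree when \<open>\<alpha> i = 0\<close>;
  the corresponding terms below carry the factor \<open>\<alpha> i\<close> and vanish.
\<close>

definition shift :: "'r \<Rightarrow> 'r \<Rightarrow> ('r \<Rightarrow> nat) \<Rightarrow> 'r \<Rightarrow> nat" where
  "shift i j \<alpha> = (\<lambda>k. (if k = i then \<alpha> k - 1 else \<alpha> k) + (if k = j then 1 else 0))"

lemma shift_in:
  assumes "\<alpha> \<in> multi_indices n" "\<alpha> i > 0"
  shows "shift i j \<alpha> \<in> multi_indices n"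
proof -
  have "(\<Sum>k\<in>UNIV. shift i j \<alpha> k) + (\<Sum>k\<in>UNIV. if k = i then 1 else 0)
      = (\<Sum>k\<in>UNIV. \<alpha> k) + (\<Sum>k\<in>UNIV. if k = j then 1 else 0)"
    unfolding sum.distrib[symmetric] using assms(2) by (intro sum.cong) (auto simp: shift_def)
  then show ?thesis using assms(1) by (simp add: multi_indices_def)
qed

text \<open>The operator is \<open>- \<Sum>\<^sub>i\<^sub>j X\<^sub>i\<^sub>j z\<^sub>j \<partial>\<^sub>i\<close>, by the product rule.\<close>

lemma std_rep_monomial:
  "std_rep X (monomial \<alpha>) z =
    - (\<Sum>i\<in>UNIV. \<Sum>j\<in>UNIV. of_nat (\<alpha> i) * X $ i $ j * monomial (shift i j \<alpha>) z)"
proof -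
  have "std_rep X (monomial \<alpha>) z =
      (\<Sum>i\<in>UNIV. std_rep X (\<lambda>z. z $ i ^ \<alpha> i) z * (\<Prod>k\<in>UNIV - {i}. z $ k ^ \<alpha> k))"
    unfolding monomial_def[abs_def]
    by (subst std_rep_prod) (auto intro: polynomial_fun_power polynomial_fun.coord)
  also have "\<dots> = (\<Sum>i\<in>UNIV. - (\<Sum>j\<in>UNIV. of_nat (\<alpha> i) * X $ i $ j * monomial (shift i j \<alpha>) z))"
  proof (intro sum.cong refl)
    fix i :: 'a
    have mono: "monomial (shift i j \<alpha>) z = z $ i ^ (\<alpha> i - 1) * z $ j * (\<Prod>k\<in>UNIV - {i}. z $ k ^ \<alpha> k)" for j
    proof -
      have "monomial (shift i j \<alpha>) z =
          (\<Prod>k\<in>UNIV. z $ k ^ (if k = i then \<alpha> k - 1 else \<alpha> k)) * (\<Prod>k\<in>UNIV. z $ k ^ (if k = j then 1 else 0))"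
        by (simp add: monomial_def shift_def power_add prod.distrib)
      also have "(\<Prod>k\<in>UNIV. z $ k ^ (if k = j then 1 else 0)) = (\<Prod>k\<in>UNIV. if k = j then z $ k else 1)"
        by (intro prod.cong) auto
      also have "\<dots> = z $ j" by simp
      also have "(\<Prod>k\<in>UNIV. z $ k ^ (if k = i then \<alpha> k - 1 else \<alpha> k))
          = z $ i ^ (\<alpha> i - 1) * (\<Prod>k\<in>UNIV - {i}. z $ k ^ \<alpha> k)"
        by (subst prod.remove[of _ i]) (auto intro!: prod.cong)
      finally show ?thesis by (simp add: ac_simps)
    qed
    have "std_rep X (\<lambda>z. z $ i ^ \<alpha> i) z = - (\<Sum>j\<in>UNIV. of_nat (\<alpha> i) * X $ i $ j * (z $ i ^ (\<alpha> i - 1) * z $ j))"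
      by (simp add: std_rep_power polynomial_fun.coord std_rep_coord matrix_vector_mult_def
          sum_distrib_left ac_simps)
    then show "std_rep X (\<lambda>z. z $ i ^ \<alpha> i) z * (\<Prod>k\<in>UNIV - {i}. z $ k ^ \<alpha> k)
        = - (\<Sum>j\<in>UNIV. of_nat (\<alpha> i) * X $ i $ j * monomial (shift i j \<alpha>) z)"
      by (simp add: mono sum_distrib_right mult.assoc)
  qed
  finally show ?thesis by (simp add: sum_negf)
qed

lemma
  assumes \<alpha>: "\<alpha> \<in> multi_indices n"
  shows std_rep_monomial_homog: "std_rep X (monomial \<alpha>) \<in> homog_polys n"
    and mcoeff_std_rep_monomial: "\<beta> \<in> multi_indices n \<Longrightarrow> mcoeff n (std_rep X (monomial \<alpha>)) \<beta> =
      - (\<Sum>i\<in>UNIV. \<Sum>j\<in>UNIV. of_nat (\<alpha> i) * X $ i $ j * (if \<beta> = shift i j \<alpha> then 1 else 0))"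
proof -
  let ?f = "\<lambda>i j z. of_nat (\<alpha> i) * X $ i $ j * monomial (shift i j \<alpha>) z"
  have f: "?f i j \<in> homog_polys n" for i j
  proof (cases "\<alpha> i = 0")
    case True
    then have "?f i j = (\<lambda>z. 0 * monomial \<alpha> z)" by simp
    then show ?thesis using homog_polys_cmult[OF monomial_homog[OF \<alpha>]] by metis
  qed (intro homog_polys_cmult monomial_homog shift_in \<alpha>, simp)
  have rep: "std_rep X (monomial \<alpha>) = (\<lambda>z. (- 1) * (\<Sum>i\<in>UNIV. \<Sum>j\<in>UNIV. ?f i j z))"
    by (simp add: fun_eq_iff std_rep_monomial)
  show "std_rep X (monomial \<alpha>) \<in> homog_polys n"
    unfolding rep by (intro homog_polys_cmult homog_polys_sum f)
  assume \<beta>: "\<beta> \<in> multi_indices n"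
  have coeff: "mcoeff n (?f i j) \<beta> = of_nat (\<alpha> i) * X $ i $ j * (if \<beta> = shift i j \<alpha> then 1 else 0)" for i j
  proof (cases "\<alpha> i = 0")
    case True
    then have "?f i j = (\<lambda>z. 0 * monomial \<alpha> z)" by simp
    then show ?thesis
      using mcoeff_cmult[OF monomial_homog[OF \<alpha>] \<beta>, of 0] True by simp
  next
    case False
    then have "shift i j \<alpha> \<in> multi_indices n" by (intro shift_in \<alpha>) simp
    then show ?thesis by (simp only: mcoeff_cmult monomial_homog \<beta> mcoeff_monomial)
  qed
  show "mcoeff n (std_rep X (monomial \<alpha>)) \<beta> =
      - (\<Sum>i\<in>UNIV. \<Sum>j\<in>UNIV. of_nat (\<alpha> i) * X $ i $ j * (if \<beta> = shift i j \<alpha> then 1 else 0))"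
    unfolding rep
    by (simp only: mcoeff_cmult[OF homog_polys_sum[OF homog_polys_sum[OF f]] \<beta>]
        mcoeff_sum[OF finite homog_polys_sum[OF f] \<beta>] mcoeff_sum[OF finite f \<beta>] coeff) simp
qed

lemma std_rep_homog:
  assumes "P \<in> homog_polys n"
  shows "std_rep X P \<in> homog_polys n"
proof -
  obtain c where P: "P = (\<lambda>z. \<Sum>\<alpha>\<in>multi_indices n. c \<alpha> * monomial \<alpha> z)"
    using assms unfolding homog_polys_iff by (elim exE)
  have "std_rep X P = (\<lambda>z. \<Sum>\<alpha>\<in>multi_indices n. c \<alpha> * std_rep X (monomial \<alpha>) z)"
    unfolding P
    by (simp only: std_rep_sum std_rep_cmult polynomial_fun.mult polynomial_fun.const polynomial_fun_monomial)
  then show ?thesis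
    by (simp only:) (intro homog_polys_sum homog_polys_cmult std_rep_monomial_homog)
qed

section \<open>Rescaled coordinates\<close>

text \<open>
  A basis \<open>v\<close> with its coordinate functions \<open>x\<close>. Declaring the basis orthogonal with prescribed lengths
  \<open>\<mu>\<close> gives a family of inner products, along which an operator keeps its trace while its matrix
  entries are multiplied by the ratios of the lengths.
\<close>

locale coordinate_space =
  fixes V :: "'v::real_vector set" and I :: "'i set" and v :: "'i \<Rightarrow> 'v" and x :: "'i \<Rightarrow> 'v \<Rightarrow> real"
  assumes finite_index: "finite I"
    and subspace_V: "subspace V"
    and v_in: "i \<in> I \<Longrightarrow> v i \<in> V"
    and x_add: "i \<in> I \<Longrightarrow> P \<in> V \<Longrightarrow> Q \<in> V \<Longrightarrow> x i (P + Q) = x i P + x i Q"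
    and x_scaleR: "i \<in> I \<Longrightarrow> P \<in> V \<Longrightarrow> x i (c *\<^sub>R P) = c * x i P"
    and x_v: "i \<in> I \<Longrightarrow> j \<in> I \<Longrightarrow> x i (v j) = (if i = j then 1 else 0)"
    and expansion: "P \<in> V \<Longrightarrow> (\<Sum>i\<in>I. x i P *\<^sub>R v i) = P"
begin

definition ip :: "('i \<Rightarrow> real) \<Rightarrow> 'v \<Rightarrow> 'v \<Rightarrow> real" where
  "ip \<mu> P Q = (\<Sum>i\<in>I. (\<mu> i)\<^sup>2 * x i P * x i Q)"

definition frame :: "('i \<Rightarrow> real) \<Rightarrow> 'v set" where
  "frame \<mu> = (\<lambda>i. (1 / \<mu> i) *\<^sub>R v i) ` I"

lemma x_sum:
  "i \<in> I \<Longrightarrow> (\<And>k. k \<in> K \<Longrightarrow> f k \<in> V) \<Longrightarrow> x i (\<Sum>k\<in>K. f k) = (\<Sum>k\<in>K. x i (f k))"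
proof (induction K rule: infinite_finite_induct)
  case empty
  show ?case using x_scaleR[OF empty(1), of 0 0] subspace_V by (simp add: subspace_def)
next
  case (infinite K)
  show ?case
    using x_scaleR[OF infinite(2), of 0 0] subspace_V infinite(1) by (simp add: subspace_def)
qed (simp add: x_add subspace_sum[OF subspace_V])

lemma ip_v:
  assumes "i \<in> I"
  shows "ip \<mu> P (v i) = (\<mu> i)\<^sup>2 * x i P"
proof -
  have "ip \<mu> P (v i) = (\<Sum>j\<in>I. if j = i then (\<mu> i)\<^sup>2 * x i P else 0)"
    unfolding ip_def using assms by (intro sum.cong) (auto simp: x_v)
  then show ?thesis using assms finite_index by simp
qed

lemma inner_product_ip:
  assumes \<mu>: "\<And>i. i \<in> I \<Longrightarrow> \<mu> i > 0"
  shows "inner_product_on V (ip \<mu>)"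
  unfolding inner_product_on_def
proof (intro conjI ballI allI impI)
  fix P assume P: "P \<in> V" "P \<noteq> 0"
  have "\<exists>i\<in>I. x i P \<noteq> 0"
  proof (rule ccontr)
    assume "\<not> ?thesis"
    then have "(\<Sum>i\<in>I. x i P *\<^sub>R v i) = 0" by (intro sum.neutral) auto
    then show False using expansion P by simp
  qed
  then obtain i where i: "i \<in> I" "x i P \<noteq> 0" by blast
  have "0 < (\<mu> i)\<^sup>2 * (x i P)\<^sup>2" using \<mu>[OF i(1)] i(2) by simp
  also have "\<dots> \<le> (\<Sum>j\<in>I. (\<mu> j)\<^sup>2 * (x j P)\<^sup>2)"
    using i(1) finite_index by (intro member_le_sum) auto
  also have "\<dots> = ip \<mu> P P" by (simp add: ip_def power2_eq_square mult.assoc)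
  finally show "0 < ip \<mu> P P" .
qed (simp_all add: ip_def x_add x_scaleR sum.distrib[symmetric] sum_distrib_left algebra_simps)

lemma orthonormal_frame_ip:
  assumes \<mu>: "\<And>i. i \<in> I \<Longrightarrow> \<mu> i > 0"
  shows "orthonormal_frame V (ip \<mu>) (frame \<mu>)"
proof
  show "inner_product_on V (ip \<mu>)" by (rule inner_product_ip[OF \<mu>])
  have "frame \<mu> \<subseteq> V"
    using v_in subspace_V by (auto simp: frame_def subspace_def)
  then have "span (frame \<mu>) \<subseteq> V" using subspace_V by (rule span_minimal)
  moreover have "V \<subseteq> span (frame \<mu>)"
  proof
    fix P assume "P \<in> V"
    then have "P = (\<Sum>i\<in>I. x i P *\<^sub>R v i)" by (simp add: expansion)
    also have "\<dots> = (\<Sum>i\<in>I. (x i P * \<mu> i) *\<^sub>R ((1 / \<mu> i) *\<^sub>R v i))"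
      using \<mu> by (intro sum.cong refl) (simp add: less_imp_neq[symmetric])
    also have "\<dots> \<in> span (frame \<mu>)"
      by (intro span_sum span_scale span_base) (auto simp: frame_def)
    finally show "P \<in> span (frame \<mu>)" .
  qed
  ultimately have "span (frame \<mu>) = V" by (rule subset_antisym)
  moreover have "ip \<mu> e f = (if e = f then 1 else 0)" if "e \<in> frame \<mu>" "f \<in> frame \<mu>" for e f
  proof -
    from that obtain i j where ij: "i \<in> I" "j \<in> I" "e = (1 / \<mu> i) *\<^sub>R v i" "f = (1 / \<mu> j) *\<^sub>R v j"
      by (auto simp: frame_def)
    have "ip \<mu> e f = (\<Sum>k\<in>I. (\<mu> k)\<^sup>2 * (x k (v i) / \<mu> i) * (x k (v j) / \<mu> j))"
      unfolding ip_def ij using ij by (intro sum.cong refl) (simp add: x_scaleR v_in)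
    also have "\<dots> = (\<Sum>k\<in>I. if k = i then (if i = j then 1 else 0) else 0)"
      using ij \<mu>[of i] by (intro sum.cong refl) (auto simp: x_v power2_eq_square)
    also have "\<dots> = (if i = j then 1 else 0)" using ij finite_index by simp
    also have "\<dots> = (if e = f then 1 else 0)"
    proof (cases "i = j")
      case False
      have "x i e \<noteq> x i f" using ij False \<mu>[of i] by (simp add: x_scaleR v_in x_v)
      then show ?thesis using False by auto
    qed (simp add: ij)
    finally show ?thesis .
  qed
  ultimately show "orthonormal_basis_on V (ip \<mu>) (frame \<mu>)"
    unfolding orthonormal_basis_on_def frame_def using finite_index by blast
qed

lemma sum_frame:
  assumes \<mu>: "\<And>i. i \<in> I \<Longrightarrow> \<mu> i > 0"
  shows "(\<Sum>e\<in>frame \<mu>. g e) = (\<Sum>i\<in>I. g ((1 / \<mu> i) *\<^sub>R v i))"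
  unfolding frame_def
proof (subst sum.reindex)
  show "inj_on (\<lambda>i. (1 / \<mu> i) *\<^sub>R v i) I"
  proof (rule inj_onI)
    fix i j assume ij: "i \<in> I" "j \<in> I" "(1 / \<mu> i) *\<^sub>R v i = (1 / \<mu> j) *\<^sub>R v j"
    then have "1 / \<mu> i * x i (v i) = 1 / \<mu> j * x i (v j)"
      by (metis x_scaleR v_in)
    then show "i = j" using ij(1,2) \<mu>[of i] by (simp add: x_v split: if_splits)
  qed
qed simp

lemma frame_trace:
  assumes \<mu>: "\<And>i. i \<in> I \<Longrightarrow> \<mu> i > 0" and T: "linear_op_on V T"
  shows "(\<Sum>e\<in>frame \<mu>. ip \<mu> (T e) e) = (\<Sum>i\<in>I. x i (T (v i)))"
proof -
  interpret orthonormal_frame V "ip \<mu>" "frame \<mu>" by (rule orthonormal_frame_ip[OF \<mu>])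
  have T_in: "T P \<in> V" if "P \<in> V" for P using T that unfolding linear_op_on_def by blast
  have "(\<Sum>e\<in>frame \<mu>. ip \<mu> (T e) e)
      = (\<Sum>i\<in>I. ip \<mu> (T ((1 / \<mu> i) *\<^sub>R v i)) ((1 / \<mu> i) *\<^sub>R v i))"
    by (rule sum_frame[OF \<mu>])
  also have "\<dots> = (\<Sum>i\<in>I. x i (T (v i)))"
  proof (intro sum.cong refl)
    fix i assume i: "i \<in> I"
    have "T ((1 / \<mu> i) *\<^sub>R v i) = (1 / \<mu> i) *\<^sub>R T (v i)"
      using T v_in[OF i] unfolding linear_op_on_def by simp
    then show "ip \<mu> (T ((1 / \<mu> i) *\<^sub>R v i)) ((1 / \<mu> i) *\<^sub>R v i) = x i (T (v i))"
      using \<mu>[OF i] T_in v_in i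
      by (simp add: ip_scaleR_left ip_scaleR_right scaleR_in ip_v x_scaleR power2_eq_square)
  qed
  finally show ?thesis .
qed

lemma frame_norm:
  assumes \<mu>: "\<And>i. i \<in> I \<Longrightarrow> \<mu> i > 0" and T: "linear_op_on V T"
  shows "(\<Sum>e\<in>frame \<mu>. ip \<mu> (T e) (T e)) = (\<Sum>i\<in>I. \<Sum>k\<in>I. (\<mu> k / \<mu> i)\<^sup>2 * (x k (T (v i)))\<^sup>2)"
proof -
  have "(\<Sum>e\<in>frame \<mu>. ip \<mu> (T e) (T e))
      = (\<Sum>i\<in>I. ip \<mu> (T ((1 / \<mu> i) *\<^sub>R v i)) (T ((1 / \<mu> i) *\<^sub>R v i)))"
    by (rule sum_frame[OF \<mu>])
  also have "\<dots> = (\<Sum>i\<in>I. \<Sum>k\<in>I. (\<mu> k / \<mu> i)\<^sup>2 * (x k (T (v i)))\<^sup>2)"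
  proof (intro sum.cong refl)
    fix i assume i: "i \<in> I"
    have "T ((1 / \<mu> i) *\<^sub>R v i) = (1 / \<mu> i) *\<^sub>R T (v i)" "T (v i) \<in> V"
      using T v_in[OF i] unfolding linear_op_on_def by simp_all
    then show "ip \<mu> (T ((1 / \<mu> i) *\<^sub>R v i)) (T ((1 / \<mu> i) *\<^sub>R v i)) =
        (\<Sum>k\<in>I. (\<mu> k / \<mu> i)\<^sup>2 * (x k (T (v i)))\<^sup>2)"
      unfolding ip_def by (intro sum.cong refl) (simp add: x_scaleR power2_eq_square)
  qed
  finally show ?thesis .
qed

lemma coordinate_of_square:
  assumes T: "linear_op_on V T" and i: "i \<in> I"
  shows "x i (T (T (v i))) = (\<Sum>k\<in>I. x k (T (v i)) * x i (T (v k)))"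
proof -
  have T_in: "T P \<in> V" if "P \<in> V" for P using T that unfolding linear_op_on_def by blast
  have T_sum: "T (\<Sum>k\<in>K. f k) = (\<Sum>k\<in>K. T (f k))" if "finite K" "\<And>k. k \<in> K \<Longrightarrow> f k \<in> V"
    for K and f :: "'i \<Rightarrow> 'v"
    using that
  proof (induction K rule: finite_induct)
    case empty
    have "T (0 *\<^sub>R 0) = 0 *\<^sub>R T 0"
      using T subspace_V unfolding linear_op_on_def subspace_def by blast
    then show ?case by simp
  next
    case (insert k K)
    then show ?case
      using T subspace_sum[OF subspace_V, of K f] unfolding linear_op_on_def by simp
  qed
  have mem: "c *\<^sub>R v k \<in> V" if "k \<in> I" for c k
    using v_in[OF that] subspace_V by (simp add: subspace_def)
  have "T (T (v i)) = T (\<Sum>k\<in>I. x k (T (v i)) *\<^sub>R v k)"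
    using expansion[OF T_in[OF v_in[OF i]]] by simp
  also have "\<dots> = (\<Sum>k\<in>I. T (x k (T (v i)) *\<^sub>R v k))"
    by (rule T_sum[OF finite_index mem])
  finally have "x i (T (T (v i))) = (\<Sum>k\<in>I. x i (T (x k (T (v i)) *\<^sub>R v k)))"
    by (simp add: x_sum[OF i] T_in mem)
  also have "\<dots> = (\<Sum>k\<in>I. x k (T (v i)) * x i (T (v k)))"
  proof (intro sum.cong refl)
    fix k assume k: "k \<in> I"
    have "T (x k (T (v i)) *\<^sub>R v k) = x k (T (v i)) *\<^sub>R T (v k)"
      using T v_in[OF k] unfolding linear_op_on_def by simp
    then show "x i (T (x k (T (v i)) *\<^sub>R v k)) = x k (T (v i)) * x i (T (v k))"
      using x_scaleR[OF i T_in[OF v_in[OF k]]] by simp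
  qed
  finally show ?thesis .
qed

end

text \<open>
  The representation is a real one, so each monomial accounts for two basis vectors. Storing the unit
  \<open>u\<close> itself in the index treats real and imaginary parts uniformly: the factor \<open>cnj u\<close> in the
  coordinate selects one of them.
\<close>

definition mono_index :: "nat \<Rightarrow> (('r::finite \<Rightarrow> nat) \<times> complex) set" where
  "mono_index n = multi_indices n \<times> {1, \<i>}"

definition mono_vec :: "('r::finite \<Rightarrow> nat) \<times> complex \<Rightarrow> complex^'r \<Rightarrow> complex" where
  "mono_vec b = (\<lambda>z. snd b * monomial (fst b) z)"

definition mono_coord :: "nat \<Rightarrow> ('r::finite \<Rightarrow> nat) \<times> complex \<Rightarrow> (complex^'r \<Rightarrow> complex) \<Rightarrow> real" where
  "mono_coord n b P = Re (cnj (snd b) * mcoeff n P (fst b))"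

lemma fun_sum_apply: "(\<Sum>i\<in>I. f i) z = (\<Sum>i\<in>I. f i z)"
  by (induction I rule: infinite_finite_induct) simp_all

lemma scaleR_fun_eq: "c *\<^sub>R P = (\<lambda>z. of_real c * P z :: complex)"
  by (simp add: scaleR_fun_def scaleR_conv_of_real)

lemma plus_fun_eq: "P + Q = (\<lambda>z. P z + Q z)"
  by (simp add: plus_fun_def)

lemma coordinate_space_homog_polys:
  "coordinate_space (homog_polys n :: (complex^'r::finite \<Rightarrow> complex) set) (mono_index n) mono_vec (mono_coord n)"
proof
  show "finite (mono_index n :: (('r \<Rightarrow> nat) \<times> complex) set)"
    by (simp add: mono_index_def finite_multi_indices)
  have "(0 :: complex^'r \<Rightarrow> complex) \<in> homog_polys n"
    by (rule homog_polysI[of _ "\<lambda>_. 0"]) (simp add: zero_fun_def)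
  then show "subspace (homog_polys n :: (complex^'r \<Rightarrow> complex) set)"
    unfolding subspace_def plus_fun_eq scaleR_fun_eq by (simp add: homog_polys_add homog_polys_cmult)
next
  fix b c :: "('r \<Rightarrow> nat) \<times> complex" and P Q :: "complex^'r \<Rightarrow> complex" and r :: real
  assume b: "b \<in> mono_index n"
  then have b1: "fst b \<in> multi_indices n" by (auto simp: mono_index_def)
  show "mono_vec b \<in> homog_polys n"
    unfolding mono_vec_def by (intro homog_polys_cmult monomial_homog b1)
  assume P: "P \<in> homog_polys n"
  show "mono_coord n b (r *\<^sub>R P) = r * mono_coord n b P"
    unfolding mono_coord_def scaleR_fun_eq mcoeff_cmult[OF P b1] by (simp add: algebra_simps)
  assume Q: "Q \<in> homog_polys n"
  show "mono_coord n b (P + Q) = mono_coord n b P + mono_coord n b Q"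
    unfolding mono_coord_def plus_fun_eq mcoeff_add[OF P Q b1] by (simp add: algebra_simps)
next
  fix b c :: "('r \<Rightarrow> nat) \<times> complex"
  assume b: "b \<in> mono_index n" and c: "c \<in> mono_index n"
  then have m: "fst b \<in> multi_indices n" "fst c \<in> multi_indices n" "snd b \<in> {1, \<i>}" "snd c \<in> {1, \<i>}"
    by (auto simp: mono_index_def)
  show "mono_coord n b (mono_vec c) = (if b = c then 1 else 0)"
    unfolding mono_coord_def mono_vec_def mcoeff_cmult[OF monomial_homog[OF m(2)] m(1)]
      mcoeff_monomial[OF m(2) m(1)]
    using m(3,4) by (auto simp: prod_eq_iff)
next
  fix P :: "complex^'r \<Rightarrow> complex"
  assume P: "P \<in> homog_polys n"
  show "(\<Sum>b\<in>mono_index n. mono_coord n b P *\<^sub>R mono_vec b) = P"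
  proof
    fix z
    have "(\<Sum>b\<in>mono_index n. mono_coord n b P *\<^sub>R mono_vec b) z
        = (\<Sum>\<alpha>\<in>multi_indices n. \<Sum>u\<in>{1, \<i>}. of_real (mono_coord n (\<alpha>, u) P) * mono_vec (\<alpha>, u) z)"
      unfolding fun_sum_apply mono_index_def scaleR_fun_eq sum.cartesian_product split_def by simp
    also have "\<dots> = (\<Sum>\<alpha>\<in>multi_indices n. mcoeff n P \<alpha> * monomial \<alpha> z)"
    proof (intro sum.cong refl)
      fix \<alpha>
      have "mcoeff n P \<alpha> = of_real (Re (mcoeff n P \<alpha>)) + of_real (Im (mcoeff n P \<alpha>)) * \<i>"
        by (simp add: complex_eq_iff)
      then show "(\<Sum>u\<in>{1, \<i>}. of_real (mono_coord n (\<alpha>, u) P) * mono_vec (\<alpha>, u) z)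
          = mcoeff n P \<alpha> * monomial \<alpha> z"
        by (simp add: mono_coord_def mono_vec_def) (metis distrib_right mult.assoc)
    qed
    also have "\<dots> = P z" by (rule mcoeff_expansion_at[OF P])
    finally show "(\<Sum>b\<in>mono_index n. mono_coord n b P *\<^sub>R mono_vec b) z = P z" .
  qed
qed

section \<open>Skew-Hermitian matrices\<close>

lemma matrix_mult_diff_right: "(A :: complex^'r::finite^'r) ** (B - C) = A ** B - A ** C"
  by (simp add: vec_eq_iff matrix_matrix_mult_def right_diff_distrib sum_subtractf)

lemma matrix_mult_diff_left: "((A :: complex^'r::finite^'r) - B) ** C = A ** C - B ** C"
  by (simp add: vec_eq_iff matrix_matrix_mult_def left_diff_distrib sum_subtractf)

lemma matrix_mult_add_left: "((A :: complex^'r::finite^'r) + B) ** C = A ** C + B ** C"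
  by (simp add: vec_eq_iff matrix_matrix_mult_def distrib_right sum.distrib)

lemma matrix_mult_scaleR_left: "(c *\<^sub>R (A :: complex^'r::finite^'r)) ** B = c *\<^sub>R (A ** B)"
  by (simp add: vec_eq_iff matrix_matrix_mult_def scaleR_sum_right)

lemma matrix_mult_scaleR_right: "(A :: complex^'r::finite^'r) ** (c *\<^sub>R B) = c *\<^sub>R (A ** B)"
  by (simp add: vec_eq_iff matrix_matrix_mult_def scaleR_sum_right)

lemma skew_hermitian_entry: "W \<in> skew_hermitian \<Longrightarrow> cnj (W $ j $ i) = - W $ i $ j"
  unfolding skew_hermitian_def ctranspose_def vec_eq_iff by simp

lemma inner_skew_hermitian:
  fixes X W :: "complex^'r::finite^'r"
  assumes "W \<in> skew_hermitian"
  shows "X \<bullet> W = - Re (trace (X ** W))"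
proof -
  have "X $ i $ j \<bullet> W $ i $ j = - Re (X $ i $ j * W $ j $ i)" for i j
  proof -
    have "X $ i $ j \<bullet> W $ i $ j = Re (X $ i $ j * cnj (W $ i $ j))"
      by (simp add: inner_complex_def)
    then show ?thesis using skew_hermitian_entry[OF assms, of i j] by simp
  qed
  then have "X \<bullet> W = - (\<Sum>i\<in>UNIV. \<Sum>j\<in>UNIV. Re (X $ i $ j * W $ j $ i))"
    unfolding inner_vec_def by (simp only: sum_negf)
  then show ?thesis by (simp add: trace_def matrix_matrix_mult_def)
qed

text \<open>
  Up to sign both sides are real parts of traces of products of three matrices, which agree by
  cyclicity. Skewness of \<open>W\<close> and of \<open>[Y, W]\<close> is what turns the inner products into such traces.
\<close>

lemma commutator_invariant:
  fixes X Y W :: "complex^'r::finite^'r"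
  assumes "W \<in> skew_hermitian" "Y ** W - W ** Y \<in> skew_hermitian"
  shows "(X ** Y - Y ** X) \<bullet> W = X \<bullet> (Y ** W - W ** Y)"
proof -
  have "trace ((X ** Y - Y ** X) ** W) = trace (X ** (Y ** W - W ** Y))"
    using trace_mul_sym[of Y "X ** W"]
    by (simp add: matrix_mult_diff_left matrix_mult_diff_right trace_sub matrix_mul_assoc)
  then show ?thesis using assms by (simp add: inner_skew_hermitian)
qed

lemma linear_square_sum_bound:
  fixes f :: "'e \<Rightarrow> 'u::euclidean_space \<Rightarrow> 'w::real_normed_vector"
  assumes "\<And>e. e \<in> E \<Longrightarrow> linear (f e)"
  shows "\<exists>C\<ge>0. \<forall>X. (\<Sum>e\<in>E. (norm (f e X))\<^sup>2) \<le> C * (norm X)\<^sup>2"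
proof -
  have "\<exists>K. \<forall>X. norm (f e X) \<le> norm X * K" if "e \<in> E" for e
    using bounded_linear.bounded linear_conv_bounded_linear assms[OF that] by metis
  then obtain K where K: "\<And>e X. e \<in> E \<Longrightarrow> norm (f e X) \<le> norm X * K e" by metis
  show ?thesis
  proof (intro exI[of _ "\<Sum>e\<in>E. (K e)\<^sup>2"] conjI allI)
    show "(\<Sum>e\<in>E. (K e)\<^sup>2) \<ge> 0" by (intro sum_nonneg) simp
    fix X
    have "(norm (f e X))\<^sup>2 \<le> (norm X * K e)\<^sup>2" if "e \<in> E" for e
      using K[OF that] by (intro power_mono) auto
    then have "(\<Sum>e\<in>E. (norm (f e X))\<^sup>2) \<le> (\<Sum>e\<in>E. (norm X * K e)\<^sup>2)" by (rule sum_mono)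
    then show "(\<Sum>e\<in>E. (norm (f e X))\<^sup>2) \<le> (\<Sum>e\<in>E. (K e)\<^sup>2) * (norm X)\<^sup>2"
      by (simp add: power_mult_distrib sum_distrib_left mult.commute)
  qed
qed

section \<open>Pure powers make the representation large\<close>

definition pure_power :: "nat \<Rightarrow> 'r \<Rightarrow> 'r \<Rightarrow> nat" where
  "pure_power n i = (\<lambda>k. if k = i then n else 0)"

text \<open>
  With these lengths exactly the matrix entries leading from a real pure power \<open>z\<^sub>i\<^sup>n\<close> to another kind of
  basis vector are magnified. Since \<open>\<i> z\<^sub>i\<^sup>n\<close> is of the other kind, this includes the entries that come
  from the imaginary diagonal of a skew-Hermitian matrix.
\<close>

definition weight :: "nat \<Rightarrow> real \<Rightarrow> ('r \<Rightarrow> nat) \<times> complex \<Rightarrow> real" where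
  "weight n s b = (if snd b = 1 \<and> fst b \<in> range (pure_power n) then 1 else s)"

lemma pure_power_in: "pure_power n (i :: 'r::finite) \<in> multi_indices n"
  by (simp add: pure_power_def multi_indices_def)

lemma shift_eq_iff: "shift i j \<alpha> = shift i k \<alpha> \<longleftrightarrow> j = k"
proof
  assume "shift i j \<alpha> = shift i k \<alpha>"
  from fun_cong[OF this, of j] show "j = k" by (simp add: shift_def split: if_splits)
qed simp

lemma shift_pure_power_in: "n > 0 \<Longrightarrow> shift i j (pure_power n i) \<in> multi_indices n"
  by (intro shift_in pure_power_in) (simp add: pure_power_def)

lemma shift_pure_power_not_pure:
  assumes "n \<ge> 2" "j \<noteq> i"
  shows "shift i j (pure_power n i) \<notin> range (pure_power n)"
proof
  assume "shift i j (pure_power n i) \<in> range (pure_power n)"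
  then obtain k where "shift i j (pure_power n i) = pure_power n k" by blast
  from fun_cong[OF this, of j] show False
    using assms by (simp add: shift_def pure_power_def split: if_splits)
qed

lemma mono_coord_std_rep:
  assumes "b \<in> mono_index n" "k \<in> mono_index n"
  shows "mono_coord n k (std_rep X (mono_vec b)) =
    Re (cnj (snd k) * (snd b * mcoeff n (std_rep X (monomial (fst b))) (fst k)))"
proof -
  have m: "fst b \<in> multi_indices n" "fst k \<in> multi_indices n"
    using assms by (auto simp: mono_index_def)
  have "std_rep X (mono_vec b) = (\<lambda>z. snd b * std_rep X (monomial (fst b)) z)"
    unfolding mono_vec_def by (rule std_rep_cmult[OF polynomial_fun_monomial])
  then show ?thesis
    unfolding mono_coord_def by (simp only: mcoeff_cmult[OF std_rep_monomial_homog[OF m(1)] m(2)])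
qed

text \<open>
  Only the terms \<open>i = j\<close> of \<open>\<Sum>\<^sub>i\<^sub>j X\<^sub>i\<^sub>j z\<^sub>j \<partial>\<^sub>i\<close> reproduce a monomial, and \<open>X\<^sub>i\<^sub>i\<close> is imaginary. This
  gives tracelessness of the representation, one diagonal entry at a time.
\<close>

lemma mono_coord_diagonal:
  assumes X: "X \<in> skew_hermitian" and b: "b \<in> mono_index n"
  shows "mono_coord n b (std_rep X (mono_vec b)) = 0"
proof -
  have m: "fst b \<in> multi_indices n" "snd b \<in> {1, \<i>}" using b by (auto simp: mono_index_def)
  have Xii: "Re (X $ i $ i) = 0" for i
    using arg_cong[OF skew_hermitian_entry[OF X, of i i], of Re] by simp
  let ?\<alpha> = "fst b"
  have fixed: "?\<alpha> = shift i j ?\<alpha> \<longleftrightarrow> j = i" if "?\<alpha> i > 0" for i j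
  proof
    assume "?\<alpha> = shift i j ?\<alpha>"
    from fun_cong[OF this, of i] show "j = i"
      using that by (simp add: shift_def split: if_splits)
  qed (use that in \<open>auto simp: shift_def fun_eq_iff\<close>)
  have "mcoeff n (std_rep X (monomial ?\<alpha>)) ?\<alpha>
      = - (\<Sum>i\<in>UNIV. \<Sum>j\<in>UNIV. of_nat (?\<alpha> i) * X $ i $ j * (if ?\<alpha> = shift i j ?\<alpha> then 1 else 0))"
    by (rule mcoeff_std_rep_monomial[OF m(1) m(1)])
  also have "\<dots> = - (\<Sum>i\<in>UNIV. \<Sum>j\<in>UNIV. if j = i then of_nat (?\<alpha> i) * X $ i $ i else 0)"
  proof -
    have "of_nat (?\<alpha> i) * X $ i $ j * (if ?\<alpha> = shift i j ?\<alpha> then 1 else 0)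
        = (if j = i then of_nat (?\<alpha> i) * X $ i $ i else 0)" for i j
      using fixed[of i j] by (cases "?\<alpha> i = 0") auto
    then show ?thesis by simp
  qed
  also have "\<dots> = - (\<Sum>i\<in>UNIV. of_nat (?\<alpha> i) * X $ i $ i)" by simp
  finally have "Re (mcoeff n (std_rep X (monomial ?\<alpha>)) ?\<alpha>) = 0"
    by (simp add: Xii Re_sum)
  then show ?thesis using m(2) unfolding mono_coord_std_rep[OF b b] by auto
qed

text \<open>
  The right-hand side is the squared Hilbert-Schmidt norm of \<open>std_rep X\<close>. It suffices to keep the
  columns of the pure powers \<open>z\<^sub>i\<^sup>n\<close>, and in each of them the entries at \<open>u z\<^sub>j z\<^sub>i\<^sup>n\<^sup>-\<^sup>1\<close>: these are
  \<open>- n Re (cnj u X\<^sub>i\<^sub>j)\<close>, and they are magnified by \<open>s\<close> whenever they are nonzero. For \<open>j \<noteq> i\<close> this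
  is because \<open>n \<ge> 2\<close>. For \<open>j = i\<close> the entry that is not magnified is \<open>- n Re X\<^sub>i\<^sub>i = 0\<close>.
\<close>

lemma weighted_norm_lower_bound:
  fixes X :: "complex^'r::finite^'r"
  assumes n: "n \<ge> 2" and X: "X \<in> skew_hermitian" and s: "s > 0"
  shows "(s * norm X)\<^sup>2 \<le> (\<Sum>b\<in>mono_index n. \<Sum>k\<in>mono_index n.
    (weight n s k / weight n s b)\<^sup>2 * (mono_coord n k (std_rep X (mono_vec b)))\<^sup>2)"
proof -
  let ?I = "mono_index n :: (('r \<Rightarrow> nat) \<times> complex) set"
  let ?t = "\<lambda>k b. mono_coord n k (std_rep X (mono_vec b))"
  let ?p = "\<lambda>i. (pure_power n i, 1 :: complex)"
  let ?q = "\<lambda>i j. shift i j (pure_power n i)"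
  have fin: "finite ?I" by (simp add: mono_index_def finite_multi_indices)
  have p_in: "?p i \<in> ?I" for i by (simp add: mono_index_def pure_power_in)
  have q_in: "(?q i j, u) \<in> ?I" if "u \<in> {1, \<i>}" for i j u
    using n that by (auto simp: mono_index_def shift_pure_power_in)
  have coeff: "mcoeff n (std_rep X (monomial (pure_power n i))) (?q i j) = - of_nat n * X $ i $ j" for i j
  proof -
    have "mcoeff n (std_rep X (monomial (pure_power n i))) (?q i j) =
        - (\<Sum>a\<in>UNIV. \<Sum>b\<in>UNIV. of_nat (pure_power n i a) * X $ a $ b *
            (if ?q i j = shift a b (pure_power n i) then 1 else 0))"
      using n by (intro mcoeff_std_rep_monomial pure_power_in shift_pure_power_in) simp
    also have "\<dots> = - (\<Sum>a\<in>UNIV. \<Sum>b\<in>UNIV. if a = i then (if b = j then of_nat n * X $ i $ j else 0) else 0)"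
    proof -
      have "of_nat (pure_power n i a) * X $ a $ b *
            (if ?q i j = shift a b (pure_power n i) then 1 else 0)
          = (if a = i then (if b = j then of_nat n * X $ i $ j else 0) else 0)" for a b
        by (auto simp: pure_power_def shift_eq_iff[unfolded pure_power_def])
      then show ?thesis by simp
    qed
    also have "\<dots> = - (\<Sum>a\<in>UNIV. if a = i then of_nat n * X $ i $ j else 0)"
      by (intro arg_cong[of _ _ uminus] sum.cong) auto
    finally show ?thesis by simp
  qed
  have t: "?t (?q i j, u) (?p i) = - (n * Re (cnj u * X $ i $ j))" if "u \<in> {1, \<i>}" for i j u
    unfolding mono_coord_std_rep[OF p_in q_in[OF that]] using that by (auto simp: coeff)
  have entry: "(s * norm (X $ i $ j))\<^sup>2 \<le>
      (\<Sum>u\<in>{1, \<i>}. (weight n s (?q i j, u))\<^sup>2 * (?t (?q i j, u) (?p i))\<^sup>2)" (is "_ \<le> ?R") for i j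
  proof -
    have "?R = (s * n)\<^sup>2 * ((Re (X $ i $ j))\<^sup>2 + (Im (X $ i $ j))\<^sup>2)"
    proof (cases "j = i")
      case True
      have "Re (X $ i $ i) = 0"
        using arg_cong[OF skew_hermitian_entry[OF X, of i i], of Re] by simp
      then show ?thesis using True by (simp add: t weight_def power_mult_distrib)
    next
      case False
      then show ?thesis
        using shift_pure_power_not_pure[OF n False]
        by (simp add: t weight_def power_mult_distrib algebra_simps)
    qed
    also have "\<dots> = (real n)\<^sup>2 * (s * norm (X $ i $ j))\<^sup>2"
      by (simp add: cmod_power2 power_mult_distrib)
    also have "\<dots> \<ge> (s * norm (X $ i $ j))\<^sup>2"
      using n mult_right_mono[of 1 "(real n)\<^sup>2" "(s * norm (X $ i $ j))\<^sup>2"] by simp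
    finally show ?thesis .
  qed
  have column: "(\<Sum>j\<in>UNIV. (s * norm (X $ i $ j))\<^sup>2) \<le>
      (\<Sum>k\<in>?I. (weight n s k / weight n s (?p i))\<^sup>2 * (?t k (?p i))\<^sup>2)" for i
  proof -
    let ?g = "\<lambda>k. (weight n s k)\<^sup>2 * (?t k (?p i))\<^sup>2"
    have inj: "inj_on (\<lambda>(j, u). (?q i j, u)) (UNIV \<times> {1, \<i>})"
      by (auto simp: inj_on_def shift_eq_iff)
    have "(\<Sum>j\<in>UNIV. (s * norm (X $ i $ j))\<^sup>2) \<le> (\<Sum>j\<in>UNIV. \<Sum>u\<in>{1, \<i>}. ?g (?q i j, u))"
      by (intro sum_mono entry)
    also have "\<dots> = (\<Sum>(j, u)\<in>UNIV \<times> {1, \<i>}. ?g (?q i j, u))" by (rule sum.cartesian_product)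
    also have "\<dots> = (\<Sum>k\<in>(\<lambda>(j, u). (?q i j, u)) ` (UNIV \<times> {1, \<i>}). ?g k)"
      by (subst sum.reindex[OF inj]) (simp add: split_def)
    also have "\<dots> \<le> (\<Sum>k\<in>?I. ?g k)"
      using fin q_in by (intro sum_mono2) auto
    also have "\<dots> = (\<Sum>k\<in>?I. (weight n s k / weight n s (?p i))\<^sup>2 * (?t k (?p i))\<^sup>2)"
      by (simp add: weight_def[of _ _ "?p i"])
    finally show ?thesis .
  qed
  have "(s * norm X)\<^sup>2 = (\<Sum>i\<in>UNIV. \<Sum>j\<in>UNIV. (s * norm (X $ i $ j))\<^sup>2)"
  proof -
    have "(norm X)\<^sup>2 = (\<Sum>i\<in>UNIV. \<Sum>j\<in>UNIV. (norm (X $ i $ j))\<^sup>2)"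
      by (simp add: power2_norm_eq_inner inner_vec_def)
    then show ?thesis by (simp add: power_mult_distrib sum_distrib_left)
  qed
  also have "\<dots> \<le> (\<Sum>i\<in>UNIV. \<Sum>k\<in>?I. (weight n s k / weight n s (?p i))\<^sup>2 * (?t k (?p i))\<^sup>2)"
    by (intro sum_mono column)
  also have "\<dots> = (\<Sum>b\<in>range ?p. \<Sum>k\<in>?I. (weight n s k / weight n s b)\<^sup>2 * (?t k b)\<^sup>2)"
  proof (subst sum.reindex)
    show "inj ?p"
    proof (rule injI)
      fix i j assume "?p i = ?p j"
      then have "pure_power n i i = pure_power n j i" by simp
      then show "i = j" using n by (simp add: pure_power_def split: if_splits)
    qed
  qed simp
  also have "\<dots> \<le> (\<Sum>b\<in>?I. \<Sum>k\<in>?I. (weight n s k / weight n s b)\<^sup>2 * (?t k b)\<^sup>2)"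
    using fin p_in by (intro sum_mono2) (auto intro!: sum_nonneg)
  finally show ?thesis .
qed

text \<open>
  The Frobenius inner product is the standard inner product of \<open>complex^'r^'r\<close>. The constants \<open>C1\<close> and
  \<open>C2\<close> bound the two quadratic forms in \<open>X\<close> that the Hilbert-Schmidt norm has to beat, namely
  \<open>\<Sum>\<^sub>e |[X, e]|\<^sup>2\<close> and \<open>- tr \<pi>(X)\<^sup>2\<close>. The second is computed in the coordinates that are not rescaled,
  which shows that \<open>C2\<close> can be chosen before \<open>s\<close>.
\<close>

theorem skew_hermitian_admits_negative_ricci:
  fixes \<uu> :: "(complex^'r::finite^'r) set"
  assumes sub: "subspace \<uu>" and skew: "\<uu> \<subseteq> skew_hermitian"
    and closed: "\<And>X Y. X \<in> \<uu> \<Longrightarrow> Y \<in> \<uu> \<Longrightarrow> X ** Y - Y ** X \<in> \<uu>"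
    and n: "n \<ge> 2"
  shows "admits_negative_ricci (ext_carrier \<uu> n) ext_bracket"
proof -
  let ?br = "\<lambda>X Y :: complex^'r^'r. X ** Y - Y ** X"
  obtain E where E: "E \<subseteq> \<uu>" "pairwise orthogonal E" "\<And>x. x \<in> E \<Longrightarrow> norm x = 1"
    "independent E" "span E = \<uu>"
    using orthonormal_basis_subspace[OF sub] by metis
  interpret U: orthonormal_frame \<uu> "(\<bullet>)" E
  proof
    show "inner_product_on \<uu> (\<bullet>)"
      unfolding inner_product_on_def by (auto simp: inner_add_left intro: inner_commute)
    show "orthonormal_basis_on \<uu> (\<bullet>) E"
      using E independent_imp_finite[OF E(4)] unfolding orthonormal_basis_on_def
      by (auto simp: pairwise_def orthogonal_def norm_eq_1)
  qed
  interpret U: metric_lie_algebra \<uu> "(\<bullet>)" E ?br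
  proof
    have lin: "linear_op_on \<uu> (?br X)" "linear_op_on \<uu> (\<lambda>Y. ?br Y X)" if "X \<in> \<uu>" for X
      using that closed unfolding linear_op_on_def
      by (auto simp: matrix_add_ldistrib matrix_mult_add_left matrix_mult_scaleR_left
          matrix_mult_scaleR_right scaleR_diff_right)
    show "lie_algebra_on \<uu> ?br"
      unfolding lie_algebra_on_def using lin U.finite_frame U.span_frame
      by (auto simp: matrix_mult_diff_left matrix_mult_diff_right matrix_mul_assoc)
  qed
  interpret C: coordinate_space "homog_polys n :: (complex^'r \<Rightarrow> complex) set" "mono_index n"
    mono_vec "mono_coord n"
    by (rule coordinate_space_homog_polys)
  let ?t = "\<lambda>k b X. mono_coord n k (std_rep X (mono_vec b))"
  have poly: "polynomial_fun (mono_vec b)" for b :: "('r \<Rightarrow> nat) \<times> complex"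
    unfolding mono_vec_def by (intro polynomial_fun.mult polynomial_fun.const polynomial_fun_monomial)
  have lin_rho: "linear_op_on (homog_polys n) (std_rep X)" for X :: "complex^'r^'r"
    unfolding linear_op_on_def plus_fun_eq scaleR_fun_eq
    by (simp add: std_rep_homog std_rep_add std_rep_cmult polynomial_fun_homog)
  have "\<exists>C\<ge>0. \<forall>X. (\<Sum>e\<in>E. (norm (?br X e))\<^sup>2) \<le> C * (norm X)\<^sup>2"
  proof (rule linear_square_sum_bound)
    show "linear (\<lambda>X. ?br X e)" for e
      by (rule linearI) (simp_all add: matrix_add_ldistrib matrix_mult_add_left
          matrix_mult_scaleR_left matrix_mult_scaleR_right scaleR_diff_right)
  qed
  then obtain C1 where C1: "C1 \<ge> 0" "\<And>X. (\<Sum>e\<in>E. (norm (?br X e))\<^sup>2) \<le> C1 * (norm X)\<^sup>2"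
    by blast
  have "\<exists>C\<ge>0. \<forall>X :: complex^'r^'r. (\<Sum>b\<in>mono_index n \<times> mono_index n. (norm (?t (fst b) (snd b) X))\<^sup>2) \<le> C * (norm X)\<^sup>2"
  proof (rule linear_square_sum_bound)
    fix b :: "(('r \<Rightarrow> nat) \<times> complex) \<times> (('r \<Rightarrow> nat) \<times> complex)"
    assume b: "b \<in> mono_index n \<times> mono_index n"
    then have m: "fst b \<in> mono_index n" "snd b \<in> mono_index n" by auto
    have hom: "std_rep X (mono_vec (snd b)) \<in> homog_polys n" for X :: "complex^'r^'r"
      using std_rep_homog C.v_in[OF m(2)] by blast
    have "std_rep (X + Y) (mono_vec (snd b)) = std_rep X (mono_vec (snd b)) + std_rep Y (mono_vec (snd b))"
      for X Y :: "complex^'r^'r"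
      by (simp add: std_rep_matrix_add[OF poly] plus_fun_eq)
    moreover have "std_rep (c *\<^sub>R X) (mono_vec (snd b)) = c *\<^sub>R std_rep X (mono_vec (snd b))"
      for c and X :: "complex^'r^'r"
      by (simp add: std_rep_matrix_scaleR[OF poly] scaleR_fun_def)
    ultimately show "linear (?t (fst b) (snd b))"
      by (intro linearI) (simp_all add: C.x_add[OF m(1) hom hom] C.x_scaleR[OF m(1) hom])
  qed
  then obtain C2 where C2: "C2 \<ge> 0"
    "\<And>X :: complex^'r^'r. (\<Sum>b\<in>mono_index n \<times> mono_index n. (norm (?t (fst b) (snd b) X))\<^sup>2) \<le> C2 * (norm X)\<^sup>2"
    by blast
  \<comment> \<open>Any \<open>s\<close> with \<open>s\<^sup>2 > C1 / 2 + C2\<close> would do.\<close>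
  define s where "s = sqrt (C1 + C2 + 1)"
  have s: "s > 0" "s\<^sup>2 = C1 + C2 + 1" using C1(1) C2(1) by (simp_all add: s_def)
  let ?\<mu> = "weight n s :: ('r \<Rightarrow> nat) \<times> complex \<Rightarrow> real"
  have \<mu>: "?\<mu> b > 0" for b using s by (simp add: weight_def)
  interpret V: orthonormal_frame "homog_polys n :: (complex^'r \<Rightarrow> complex) set" "C.ip ?\<mu>" "C.frame ?\<mu>"
    by (rule C.orthonormal_frame_ip[OF \<mu>])
  interpret ext: scalar_extension \<uu> "(\<bullet>)" E ?br "homog_polys n" "C.ip ?\<mu>" "C.frame ?\<mu>" std_rep
  proof
    have "(pure_power n undefined, 1) \<in> mono_index n"
      by (simp add: mono_index_def pure_power_in)
    then show "C.frame ?\<mu> \<noteq> {}" unfolding C.frame_def by blast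
  next
    fix X Y :: "complex^'r^'r" and P :: "complex^'r \<Rightarrow> complex" and c :: real
    show "linear_op_on (homog_polys n) (std_rep X)" by (rule lin_rho)
    assume "P \<in> homog_polys n"
    then have P: "polynomial_fun P" by (rule polynomial_fun_homog)
    show "std_rep (X + Y) P = std_rep X P + std_rep Y P"
      by (simp add: std_rep_matrix_add[OF P] plus_fun_eq)
    show "std_rep (c *\<^sub>R X) P = c *\<^sub>R std_rep X P"
      by (simp add: std_rep_matrix_scaleR[OF P] scaleR_fun_def)
    show "std_rep (?br X Y) P = std_rep X (std_rep Y P) - std_rep Y (std_rep X P)"
      by (simp add: std_rep_commutator[OF P] fun_diff_def)
  next
    fix X assume X: "X \<in> \<uu>"
    show "(\<Sum>v\<in>C.frame ?\<mu>. C.ip ?\<mu> (std_rep X v) v) = 0"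
      unfolding C.frame_trace[OF \<mu> lin_rho] using X skew by (simp add: mono_coord_diagonal subset_iff)
  next
    fix X Y W assume "X \<in> \<uu>" "Y \<in> \<uu>" "W \<in> \<uu>"
    then show "?br X Y \<bullet> W = X \<bullet> ?br Y W"
      using skew closed by (intro commutator_invariant) blast+
  qed
  have "(1 / 2) * (\<Sum>e\<in>E. ?br X e \<bullet> ?br X e) <
      (\<Sum>v\<in>C.frame ?\<mu>. C.ip ?\<mu> (std_rep X (std_rep X v)) v)
      + (\<Sum>v\<in>C.frame ?\<mu>. C.ip ?\<mu> (std_rep X v) (std_rep X v))"
    if X: "X \<in> \<uu>" "X \<noteq> 0" for X
  proof -
    have lin2: "linear_op_on (homog_polys n) (\<lambda>P. std_rep X (std_rep X P))"
      using lin_rho[of X] unfolding linear_op_on_def by simp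
    have "(\<Sum>v\<in>C.frame ?\<mu>. C.ip ?\<mu> (std_rep X (std_rep X v)) v)
        = (\<Sum>b\<in>mono_index n. \<Sum>k\<in>mono_index n. ?t k b X * ?t b k X)"
      unfolding C.frame_trace[OF \<mu> lin2]
      by (intro sum.cong refl C.coordinate_of_square lin_rho)
    also have "\<dots> \<ge> - (\<Sum>b\<in>mono_index n. \<Sum>k\<in>mono_index n. ((?t k b X)\<^sup>2 + (?t b k X)\<^sup>2) / 2)"
      unfolding sum_negf[symmetric]
    proof (intro sum_mono)
      fix b k
      have "- ((x\<^sup>2 + y\<^sup>2) / 2) \<le> x * y" for x y :: real
        using sum_squares_bound[of x "- y"] by (simp add: field_simps)
      then show "- (((?t k b X)\<^sup>2 + (?t b k X)\<^sup>2) / 2) \<le> ?t k b X * ?t b k X" .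
    qed
    also have "(\<Sum>b\<in>mono_index n. \<Sum>k\<in>mono_index n. ((?t k b X)\<^sup>2 + (?t b k X)\<^sup>2) / 2)
        = (\<Sum>b\<in>mono_index n \<times> mono_index n. (norm (?t (fst b) (snd b) X))\<^sup>2)"
    proof -
      have "(\<Sum>b\<in>mono_index n. \<Sum>k\<in>mono_index n. (?t k b X)\<^sup>2)
          = (\<Sum>b\<in>mono_index n. \<Sum>k\<in>mono_index n. (?t b k X)\<^sup>2)"
        by (rule sum.swap)
      then show ?thesis
        by (simp add: sum.distrib sum_divide_distrib[symmetric] add_divide_distrib
            sum.cartesian_product split_def)
    qed
    finally have tr: "(\<Sum>v\<in>C.frame ?\<mu>. C.ip ?\<mu> (std_rep X (std_rep X v)) v) \<ge> - (C2 * (norm X)\<^sup>2)"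
      using C2(2)[of X] by linarith
    have "(\<Sum>v\<in>C.frame ?\<mu>. C.ip ?\<mu> (std_rep X v) (std_rep X v)) \<ge> (s * norm X)\<^sup>2"
      unfolding C.frame_norm[OF \<mu> lin_rho]
      using weighted_norm_lower_bound[OF n _ s(1), of X] X skew by blast
    moreover have "(s * norm X)\<^sup>2 = C1 * (norm X)\<^sup>2 + C2 * (norm X)\<^sup>2 + (norm X)\<^sup>2"
      by (simp add: power_mult_distrib s(2) algebra_simps)
    moreover have "(norm X)\<^sup>2 > 0" using X by simp
    moreover have "(\<Sum>e\<in>E. ?br X e \<bullet> ?br X e) \<le> C1 * (norm X)\<^sup>2"
      using C1(2)[of X] by (simp add: power2_norm_eq_inner)
    moreover have "C1 * (norm X)\<^sup>2 \<ge> 0" using C1 by simp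
    ultimately show ?thesis using tr by linarith
  qed
  then have "admits_negative_ricci ext.L ext.br" by (rule ext.admits_negative_ricci)
  moreover have "ext.L = ext_carrier \<uu> n" by (simp add: ext.L_def ext_carrier_def)
  moreover have "ext.br = (ext_bracket :: 'r ext \<Rightarrow> 'r ext \<Rightarrow> 'r ext)"
  proof (intro ext)
    fix x y :: "'r ext"
    show "ext.br x y = ext_bracket x y"
      by (cases x; cases y) (simp add: ext.br_triple)
  qed
  ultimately show ?thesis by simp
qed

section \<open>The compact matrix algebras\<close>

lemma transpose_diff: "transpose (A - B :: complex^'r::finite^'r) = transpose A - transpose B"
  by (simp add: transpose_def vec_eq_iff)

lemma skew_hermitian_commutator:
  fixes X Y :: "complex^'r::finite^'r"
  assumes "X \<in> skew_hermitian" "Y \<in> skew_hermitian"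
  shows "X ** Y - Y ** X \<in> skew_hermitian"
proof -
  have "ctranspose (X ** Y - Y ** X) = - (X ** Y - Y ** X)"
    using skew_hermitian_entry[OF assms(1)] skew_hermitian_entry[OF assms(2)]
    by (simp add: ctranspose_def vec_eq_iff matrix_matrix_mult_def cnj_sum sum_subtractf mult.commute)
  then show ?thesis by (simp add: skew_hermitian_def)
qed

lemma subspace_skew_hermitian: "subspace (skew_hermitian :: (complex^'r::finite^'r) set)"
  by (simp add: subspace_def skew_hermitian_def ctranspose_def vec_eq_iff)

lemma su_admits_negative_ricci:
  "n \<ge> 2 \<Longrightarrow> admits_negative_ricci (ext_carrier (su :: (complex^'r::finite^'r) set) n) ext_bracket"
proof (rule skew_hermitian_admits_negative_ricci)
  show "subspace (su :: (complex^'r^'r) set)"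
    using subspace_skew_hermitian unfolding su_def subspace_def
    by (auto simp: trace_def sum.distrib scaleR_sum_right[symmetric])
  show "X ** Y - Y ** X \<in> su" if "X \<in> su" "Y \<in> su" for X Y :: "complex^'r^'r"
    using that skew_hermitian_commutator[of X Y] trace_mul_sym[of X Y] by (simp add: su_def trace_sub)
qed (auto simp: su_def)

lemma so_iff: "X \<in> so \<longleftrightarrow> (\<forall>i j. X $ i $ j \<in> \<real> \<and> X $ j $ i = - X $ i $ j)"
  by (auto simp: so_def transpose_def vec_eq_iff)

lemma so_admits_negative_ricci:
  "n \<ge> 2 \<Longrightarrow> admits_negative_ricci (ext_carrier (so :: (complex^'r::finite^'r) set) n) ext_bracket"
proof (rule skew_hermitian_admits_negative_ricci)
  show "subspace (so :: (complex^'r^'r) set)"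
    unfolding subspace_def
  proof (intro conjI ballI allI)
    fix X Y :: "complex^'r^'r" and c :: real
    assume X: "X \<in> so"
    have "(c *\<^sub>R X) $ i $ j \<in> \<real>" "(c *\<^sub>R X) $ j $ i = - (c *\<^sub>R X) $ i $ j" for i j
      using X[unfolded so_iff, rule_format, of i j] by (simp_all add: scaleR_conv_of_real[where 'a = complex])
    then show "c *\<^sub>R X \<in> so" unfolding so_iff by blast
    assume Y: "Y \<in> so"
    have "(X + Y) $ i $ j \<in> \<real>" "(X + Y) $ j $ i = - (X + Y) $ i $ j" for i j
      using X[unfolded so_iff, rule_format, of i j] Y[unfolded so_iff, rule_format, of i j] by simp_all
    then show "X + Y \<in> so" unfolding so_iff by blast
  qed (simp add: so_iff)
  show "so \<subseteq> (skew_hermitian :: (complex^'r^'r) set)"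
  proof
    fix X :: "complex^'r^'r" assume X: "X \<in> so"
    have "cnj (X $ j $ i) = - X $ i $ j" for i j
      using X[unfolded so_iff, rule_format, of i j] by (auto simp: Reals_cnj_iff)
    then show "X \<in> skew_hermitian"
      by (simp add: skew_hermitian_def ctranspose_def vec_eq_iff)
  qed
  show "X ** Y - Y ** X \<in> so" if X: "X \<in> so" and Y: "Y \<in> so" for X Y :: "complex^'r^'r"
  proof -
    have XY: "transpose X = - X" "transpose Y = - Y"
      using X Y by (auto simp: so_def)
    have neg: "(- A) ** (- B) = A ** B" for A B :: "complex^'r^'r"
      by (simp add: vec_eq_iff matrix_matrix_mult_def)
    have "transpose (X ** Y - Y ** X) = - (X ** Y - Y ** X)"
      by (simp add: transpose_diff matrix_transpose_mul XY neg)
    moreover have "(X ** Y - Y ** X) $ i $ j \<in> \<real>" for i j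
    proof -
      have "(\<Sum>k\<in>UNIV. A $ i $ k * B $ k $ j) \<in> \<real>" if "A \<in> so" "B \<in> so" for A B :: "complex^'r^'r"
        using that by (intro sum_in_Reals Reals_mult) (auto simp: so_def)
      then show ?thesis using X Y by (simp add: matrix_matrix_mult_def)
    qed
    ultimately show ?thesis by (simp add: so_def)
  qed
qed

text \<open>
  Closedness under commutators: moving \<open>J\<close> to the left past a transpose gives the matrix itself with
  a sign, so \<open>(X Y)\<^sup>T J = J Y X\<close> and \<open>(Y X)\<^sup>T J = J X Y\<close>.
\<close>

lemma sp_admits_negative_ricci:
  "n \<ge> 2 \<Longrightarrow> admits_negative_ricci
    (ext_carrier (sp :: (complex^('m::finite + 'm)^('m + 'm)) set) n) ext_bracket"
proof (rule skew_hermitian_admits_negative_ricci)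
  let ?J = "symp_form :: complex^('m + 'm)^('m + 'm)"
  have sub: "subspace (sp_complex :: (complex^('m + 'm)^('m + 'm)) set)"
    unfolding subspace_def
  proof (intro conjI ballI allI)
    show "0 \<in> (sp_complex :: (complex^('m + 'm)^('m + 'm)) set)"
      by (simp add: sp_complex_def vec_eq_iff matrix_matrix_mult_def transpose_def)
  next
    fix X Y :: "complex^('m + 'm)^('m + 'm)"
    assume XY: "X \<in> sp_complex" "Y \<in> sp_complex"
    have "transpose (X + Y) ** ?J + ?J ** (X + Y)
        = (transpose X ** ?J + ?J ** X) + (transpose Y ** ?J + ?J ** Y)"
      by (simp add: transpose_def vec_eq_iff matrix_matrix_mult_def distrib_left distrib_right
          sum.distrib)
    then show "X + Y \<in> sp_complex" using XY by (simp add: sp_complex_def)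
  next
    fix c :: real and X :: "complex^('m + 'm)^('m + 'm)"
    assume X: "X \<in> sp_complex"
    have "transpose (c *\<^sub>R X) ** ?J + ?J ** (c *\<^sub>R X) = c *\<^sub>R (transpose X ** ?J + ?J ** X)"
      by (simp add: transpose_def vec_eq_iff matrix_matrix_mult_def scaleR_sum_right scaleR_add_right)
    then show "c *\<^sub>R X \<in> sp_complex" using X by (simp add: sp_complex_def)
  qed
  then show "subspace (sp :: (complex^('m + 'm)^('m + 'm)) set)"
    unfolding sp_def by (intro subspace_inter subspace_skew_hermitian)
  show "X ** Y - Y ** X \<in> sp" if X: "X \<in> sp" and Y: "Y \<in> sp" for X Y :: "complex^('m + 'm)^('m + 'm)"
  proof -
    have JX: "transpose X ** ?J = - (?J ** X)" and JY: "transpose Y ** ?J = - (?J ** Y)"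
      using X Y by (auto simp: sp_def sp_complex_def add_eq_0_iff)
    have neg: "(A :: complex^('m + 'm)^('m + 'm)) ** (- B) = - (A ** B)" "(- A) ** B = - (A ** B)" for A B
      by (simp_all add: vec_eq_iff matrix_matrix_mult_def sum_negf)
    have "transpose Y ** (transpose X ** ?J) = ?J ** Y ** X"
      unfolding JX neg matrix_mul_assoc JY by simp
    moreover have "transpose X ** (transpose Y ** ?J) = ?J ** X ** Y"
      unfolding JY neg matrix_mul_assoc JX by simp
    ultimately have "transpose (X ** Y - Y ** X) ** ?J + ?J ** (X ** Y - Y ** X) = 0"
      by (simp add: transpose_diff matrix_transpose_mul matrix_mult_diff_left matrix_mult_diff_right
          matrix_mul_assoc)
    then show ?thesis
      using X Y skew_hermitian_commutator[of X Y] by (simp add: sp_def sp_complex_def)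
  qed
qed (auto simp: sp_def)

theorem theorem1p1:
  fixes n :: nat
  assumes "n \<ge> 2" and "CARD('m::finite) \<ge> 2"
  shows "admits_negative_ricci (ext_carrier (su :: (complex^'m^'m) set) n) ext_bracket \<and>
         admits_negative_ricci (ext_carrier (so :: (complex^'m^'m) set) n) ext_bracket \<and>
         admits_negative_ricci (ext_carrier (sp :: (complex^('m + 'm)^('m + 'm)) set) n) ext_bracket"
  using su_admits_negative_ricci so_admits_negative_ricci sp_admits_negative_ricci assms(1) by blast

end
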